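(* Let $\theta\in(0,1]$ and let $\mathbb{T}\colon\mathcal{H}\to\mathcal{H}$ be $\theta$-averaged with respect to $\|\cdot\|_M$, with infimal displacement vector $\mathbf{v}$. Let $\mathcal{I}^0,\mathcal{I}^1,\ldots$ be IID random vectors in $[0,1]^m$ whose common distribution (that of $\mathcal{I}$) satisfies $\mathbb{E}[\mathcal{I}]=\alpha\mathbf{1}$ with some $\alpha\in(0,1]$, and assume that $\beta>0$ satisfies $\beta<\alpha/\theta$ and $$\mathbb{E}_{\mathcal{I}}\left[\|u_{\mathcal{I}}\|_M^2\right]\le\beta\|u\|_M^2\qquad\text{for all }u\in\mathcal{H}.$$ Let $x^0\in\mathcal{H}$ and $x^{k+1}=\mathbb{T}_{\mathcal{I}^k}x^k$ for $k=0,1,2,\dots$. Suppose $\|\mathbf{v}\|_M\le\delta$ for some $\delta>0$ (the null hypothesis), and let $\varepsilon$ satisfy $\alpha\delta<\varepsilon$. Then $$\limsup_{k\to\infty}\;k\,\mathbb{P}\left(\left\|\frac{x^k}{k}\right\|_M\ge\varepsilon\right)\le\frac{(\beta-\alpha^2)\delta^2}{(\varepsilon-\alpha\delta)^2}.$$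
   Context: $\mathcal{H}=\mathcal{H}_1\oplus\cdots\oplus\mathcal{H}_m$ is a direct sum of real Hilbert spaces, with $\langle x,y\rangle=\sum_{i=1}^m\langle x_i,y_i\rangle_i$, where $x_i\in\mathcal{H}_i$ is the $i$th block of $x$. $M\colon\mathcal{H}\to\mathcal{H}$ is a bounded, linear, self-adjoint, positive definite operator; $\langle x,y\rangle_M=\langle x,My\rangle$ and $\|x\|_M=\sqrt{\langle x,Mx\rangle}$, and $\mathcal{H}$ with $\langle\cdot,\cdot\rangle_M$ is again a Hilbert space. $\mathrm{Id}$ is the identity operator. An operator $\mathbb{T}$ is $\theta$-averaged with respect to a norm, $\theta\in(0,1]$, if $\mathbb{T}=(1-\theta)\mathrm{Id}+\theta\mathbb{C}$ for some operator $\mathbb{C}$ that is non-expansive (1-Lipschitz) in that norm; for $\theta=1$ this just means $\mathbb{T}$ is non-expansive. Put $\mathbb{S}=\theta^{-1}(\mathrm{Id}-\mathbb{T})$ and $\mathbb{S}_ix=(0,\dots,0,(\mathbb{S}x)_i,0,\dots,0)$ (only the $i$th block kept). For a selection vector $\mathcal{I}=(\mathcal{I}_1,\dots,\mathcal{I}_m)\in[0,1]^m$ put $\mathbb{S}_{\mathcal{I}}=\sum_{i=1}^m\mathcal{I}_i\mathbb{S}_i$, $\mathbb{T}_{\mathcal{I}}=\mathrm{Id}-\theta\mathbb{S}_{\mathcal{I}}$, and, for $u\in\mathcal{H}$, $u_{\mathcal{I}}=\sum_{i=1}^m\mathcal{I}_i(0,\dots,0,u_i,0,\dots,0)$. $\mathbf{1}\in\mathbb{R}^m$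 is the all-ones vector. The infimal displacement vector $\mathbf{v}$ of $\mathbb{T}$ is the unique minimum-$M$-norm element of the nonempty closed convex set $\overline{\mathrm{range}(\mathrm{Id}-\mathbb{T})}$. The starting point $x^0$ is deterministic. *)

theory Defs
  imports "HOL-Probability.Probability"
begin

text \<open>
  The blocks are Hilbert spaces of possibly different dimensions, so the direct sum is taken
  internally: the \<^term>\<open>H i\<close> are pairwise orthogonal complete subspaces of the ambient type, and
  an element of \<^term>\<open>H i\<close> stands for the vector with that entry in block i and 0 elsewhere.
  The formula for the inner product is the lemma \<open>inner_eq_sum_block\<close> below.
\<close>

definition hilbert_direct_sum :: "('m::finite \<Rightarrow> 'a::{real_inner,complete_space} set) \<Rightarrow> bool" where
  "hilbert_direct_sum H \<longleftrightarrow>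
     (\<forall>i. subspace (H i) \<and> Topological_Spaces.complete (H i)) \<and>
     (\<forall>i j. i \<noteq> j \<longrightarrow> (\<forall>x\<in>H i. \<forall>y\<in>H j. orthogonal x y)) \<and>
     (\<forall>x. \<exists>b. (\<forall>i. b i \<in> H i) \<and> x = (\<Sum>i\<in>UNIV. b i))"

definition block :: "('m::finite \<Rightarrow> 'a::{real_inner,complete_space} set) \<Rightarrow> 'm \<Rightarrow> 'a \<Rightarrow> 'a" where
  "block H i x = (THE b. (\<forall>j. b j \<in> H j) \<and> x = (\<Sum>j\<in>UNIV. b j)) i"

definition positive_definite_operator :: "('a::real_inner \<Rightarrow> 'a) \<Rightarrow> bool" where
  "positive_definite_operator M \<longleftrightarrow>
     bounded_linear M \<and> (\<forall>x y. inner (M x) y = inner x (M y)) \<and>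
     (\<forall>x. x \<noteq> 0 \<longrightarrow> inner x (M x) > 0)"

definition norm_wrt :: "('a::real_inner \<Rightarrow> 'a) \<Rightarrow> 'a \<Rightarrow> real" where
  "norm_wrt M x = sqrt (inner x (M x))"

text \<open>In infinite dimensions strict positivity does not imply completeness of the new norm.\<close>

definition complete_wrt :: "('a::real_inner \<Rightarrow> 'a) \<Rightarrow> bool" where
  "complete_wrt M \<longleftrightarrow> Metric_space.mcomplete UNIV (\<lambda>x y. norm_wrt M (x - y))"

definition averaged :: "('a::real_inner \<Rightarrow> 'a) \<Rightarrow> real \<Rightarrow> ('a \<Rightarrow> 'a) \<Rightarrow> bool" where
  "averaged M \<theta> T \<longleftrightarrow>
     (\<exists>C. (\<forall>x y. norm_wrt M (C x - C y) \<le> norm_wrt M (x - y)) \<and>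
          (\<forall>x. T x = (1 - \<theta>) *\<^sub>R x + \<theta> *\<^sub>R C x))"

definition infimal_displacement_vector ::
    "('a::real_inner \<Rightarrow> 'a) \<Rightarrow> ('a \<Rightarrow> 'a) \<Rightarrow> 'a \<Rightarrow> bool" where
  "infimal_displacement_vector M T v \<longleftrightarrow>
     is_arg_min (norm_wrt M) (\<lambda>w. w \<in> closure (range (\<lambda>x. x - T x))) v"

definition S_op :: "real \<Rightarrow> ('a::real_inner \<Rightarrow> 'a) \<Rightarrow> 'a \<Rightarrow> 'a" where
  "S_op \<theta> T x = inverse \<theta> *\<^sub>R (x - T x)"

definition S_block ::
    "('m::finite \<Rightarrow> 'a::{real_inner,complete_space} set) \<Rightarrow> real \<Rightarrow> ('a \<Rightarrow> 'a) \<Rightarrow> 'm \<Rightarrow> 'a \<Rightarrow> 'a" where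
  "S_block H \<theta> T i x = block H i (S_op \<theta> T x)"

definition S_sel ::
    "('m::finite \<Rightarrow> 'a::{real_inner,complete_space} set) \<Rightarrow> real \<Rightarrow> ('a \<Rightarrow> 'a) \<Rightarrow> real^'m \<Rightarrow> 'a \<Rightarrow> 'a" where
  "S_sel H \<theta> T s x = (\<Sum>i\<in>UNIV. (s $ i) *\<^sub>R S_block H \<theta> T i x)"

definition T_sel ::
    "('m::finite \<Rightarrow> 'a::{real_inner,complete_space} set) \<Rightarrow> real \<Rightarrow> ('a \<Rightarrow> 'a) \<Rightarrow> real^'m \<Rightarrow> 'a \<Rightarrow> 'a" where
  "T_sel H \<theta> T s x = x - \<theta> *\<^sub>R S_sel H \<theta> T s x"

definition vec_sel ::
    "('m::finite \<Rightarrow> 'a::{real_inner,complete_space} set) \<Rightarrow> 'a \<Rightarrow> real^'m \<Rightarrow> 'a" where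
  "vec_sel H u s = (\<Sum>i\<in>UNIV. (s $ i) *\<^sub>R block H i u)"

lemma orthogonal_blocks:
  assumes "hilbert_direct_sum H" and "i \<noteq> j" and "x \<in> H i" and "y \<in> H j"
  shows "inner x y = 0"
  using assms unfolding hilbert_direct_sum_def orthogonal_def by blast

lemma orthogonal_sum_unique:
  assumes H: "hilbert_direct_sum H"
    and b: "\<And>i. b i \<in> H i" and c: "\<And>i. c i \<in> H i"
    and eq: "(\<Sum>i\<in>UNIV. b i) = (\<Sum>i\<in>UNIV. c i)"
  shows "b = c"
proof
  fix i
  define d where "d j = b j - c j" for j
  have d: "d j \<in> H j" for j
    using H b c unfolding d_def hilbert_direct_sum_def by (auto intro: subspace_diff)
  have "inner (d i) (\<Sum>j\<in>UNIV. d j) = (\<Sum>j\<in>UNIV. if j = i then inner (d i) (d i) else 0)"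
    unfolding inner_sum_right
  proof (rule sum.cong[OF refl])
    fix j
    show "inner (d i) (d j) = (if j = i then inner (d i) (d i) else 0)"
      using orthogonal_blocks[OF H _ d d, of i j] by auto
  qed
  moreover have "(\<Sum>j\<in>UNIV. d j) = 0"
    by (simp add: d_def sum_subtractf eq)
  ultimately have "inner (d i) (d i) = 0" by simp
  then show "b i = c i" by (simp add: d_def)
qed

lemma block_decomposition:
  assumes H: "hilbert_direct_sum H"
  shows "block H i x \<in> H i" and "x = (\<Sum>i\<in>UNIV. block H i x)"
proof -
  obtain b where b: "\<forall>i. b i \<in> H i" "x = (\<Sum>i\<in>UNIV. b i)"
    using H unfolding hilbert_direct_sum_def by blast
  have "(THE b. (\<forall>j. b j \<in> H j) \<and> x = (\<Sum>j\<in>UNIV. b j)) = b"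
  proof (rule the_equality)
    show "c = b" if "(\<forall>j. c j \<in> H j) \<and> x = (\<Sum>j\<in>UNIV. c j)" for c
      by (rule orthogonal_sum_unique[OF H]) (use b that in auto)
  qed (use b in auto)
  then have "block H j x = b j" for j by (simp add: block_def)
  with b show "block H i x \<in> H i" and "x = (\<Sum>i\<in>UNIV. block H i x)" by auto
qed

lemma inner_eq_sum_block:
  assumes H: "hilbert_direct_sum H"
  shows "inner x y = (\<Sum>i\<in>UNIV. inner (block H i x) (block H i y))"
proof -
  have *: "inner (block H i x) y = inner (block H i x) (block H i y)" for i
  proof -
    have "inner (block H i x) (\<Sum>j\<in>UNIV. block H j y)
        = (\<Sum>j\<in>UNIV. if j = i then inner (block H i x) (block H i y) else 0)"
      unfolding inner_sum_right
    proof (rule sum.cong[OF refl])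
      fix j
      show "inner (block H i x) (block H j y)
          = (if j = i then inner (block H i x) (block H i y) else 0)"
        using orthogonal_blocks[OF H _ block_decomposition(1)[OF H] block_decomposition(1)[OF H],
            of i j x y] by auto
    qed
    then show ?thesis using block_decomposition(2)[OF H, of y] by simp
  qed
  have "inner x y = inner (\<Sum>i\<in>UNIV. block H i x) y"
    using block_decomposition(2)[OF H, of x] by simp
  then show ?thesis by (simp add: inner_sum_left *)
qed

end

theory Submission
  imports Defs
begin

text \<open>
  Write \<open>R = Id - T\<close>, \<open>|.|\<close> for the \<open>M\<close>-norm and \<open>r\<^sub>s\<close> for the vector \<open>r\<close> with its blocks
  weighted by the selection \<open>s\<close>. The iteration is \<open>x' = x - (R x)\<^sub>s\<close>, a random perturbation of
  the deterministic map \<open>z \<mapsto> z - \<alpha> R z\<close>. The proof compares \<open>x\<^sup>k\<close> with an orbit \<open>z\<^sub>k\<close> of this map whose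
  first displacement \<open>R z\<^sub>0\<close> has norm \<open>\<rho>\<close> close to \<open>|v|\<close>. Since \<open>T\<close> is averaged, \<open>|R z\<^sub>k|\<close> does not
  increase, so \<open>|z\<^sub>k| \<le> |z\<^sub>0| + k \<alpha> \<rho>\<close>, and Chebyshev's inequality reduces the claim to
  \<open>limsup E|x\<^sup>k - z\<^sub>k|\<^sup>2 / k \<le> (\<beta> - \<alpha>\<^sup>2) |v|\<^sup>2 + (an error that vanishes as \<rho> \<rightarrow> |v|)\<close>.

  Put \<open>d = x - z\<close>, \<open>w = R z\<close> and \<open>h = R x - R z\<close>. The second-moment hypothesis and cocoercivity of \<open>R\<close>
  give (\<open>integral_sq_step\<close>)
  \<open>E|d'|\<^sup>2 \<le> |d|\<^sup>2 - (\<alpha>/\<theta> - \<beta>) |h|\<^sup>2 + 2 (\<beta> - \<alpha>\<^sup>2) \<langle>h, w\<rangle> + (\<beta> - \<alpha>\<^sup>2) |w|\<^sup>2\<close>.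
  The last term is the desired variance per step. The cross term has no sign, but \<open>\<alpha> h\<close> is the mean of
  \<open>d - d'\<close>, so along a constant \<open>w\<close> it would telescope. Hence
  \<open>|d|\<^sup>2 + 2 \<kappa> \<langle>d, w\<rangle>\<close> with \<open>\<kappa> = (\<beta> - \<alpha>\<^sup>2) / \<alpha>\<close> is used as a Lyapunov function; it absorbs the cross term
  (\<open>integral_lyap_step\<close>), and what remains is the error \<open>2 \<kappa> \<langle>d, w' - w\<rangle>\<close> caused by the change of \<open>w\<close>.

  This error is small because \<open>w\<close> hardly moves: \<open>|w|\<^sup>2 - |w'|\<^sup>2 \<ge> (1/(\<alpha>\<theta>) - 1) |w' - w|\<^sup>2\<close>, and \<open>|w|\<^sup>2\<close> can
  decrease by \<open>\<rho>\<^sup>2 - |v|\<^sup>2\<close> at most in total (\<open>sum_sq_R_ref_diff\<close>). Here \<open>\<alpha>\<theta> < 1\<close>, because Jensen's inequality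
  gives \<open>\<alpha>\<^sup>2 \<le> \<beta>\<close>, and \<open>\<beta> < \<alpha>/\<theta>\<close>. Young's inequality with weight \<open>\<sigma>/k\<close> then bounds the
  accumulated error by a multiple of \<open>k (\<sigma> + (\<rho>\<^sup>2 - |v|\<^sup>2)/\<sigma>)\<close> up to a constant (\<open>msd_linear_growth\<close>). Letting first
  \<open>\<rho> \<rightarrow> |v|\<close> and then \<open>\<sigma> \<rightarrow> 0\<close> yields the bound with \<open>|v|\<close> in place of \<open>\<delta>\<close>, and that bound is
  nondecreasing in \<open>|v|\<close>. The vector \<open>v\<close> enters only through \<open>|v| = inf |R x|\<close>.

  Two points concern measurability. The space need not be separable, so \<open>x\<^sup>k\<close> is never integrated as a
  vector: it is a continuous function of the selections, which live in a second countable space, and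
  only real-valued continuous functions of \<open>x\<^sup>k\<close> are integrated (\<open>expectation_step\<close>). Continuity needs \<open>T\<close>, which is
  Lipschitz in the \<open>M\<close>-norm, and the blocks, which are bounded in the original norm, to be
  continuous in the same topology. The two norms are equivalent by the open mapping argument of
  \<open>norm_le_norm_wrt\<close>.
\<close>

section \<open>The geometry of the weighted inner product\<close>

locale positive_definite =
  fixes M :: "'a::{real_inner,complete_space} \<Rightarrow> 'a"
  assumes pd: "positive_definite_operator M"
begin

definition ip :: "'a \<Rightarrow> 'a \<Rightarrow> real" where
  "ip x y = inner x (M y)"

lemma bounded_linear_M: "bounded_linear M"
  using pd by (simp add: positive_definite_operator_def)

lemma ip_commute: "ip x y = ip y x"
  using pd by (metis ip_def inner_commute positive_definite_operator_def)

lemma bilinear_ip: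
  "ip (x + y) z = ip x z + ip y z" "ip z (x + y) = ip z x + ip z y"
  "ip (x - y) z = ip x z - ip y z" "ip z (x - y) = ip z x - ip z y"
  "ip (c *\<^sub>R x) z = c * ip x z" "ip z (c *\<^sub>R x) = c * ip z x"
  "ip (- x) z = - ip x z" "ip z (- x) = - ip z x"
  using bounded_linear.linear[OF bounded_linear_M]
  by (simp_all add: ip_def inner_simps linear_add linear_diff linear_cmul linear_neg)

lemma ip_zero [simp]: "ip 0 x = 0" "ip x 0 = 0"
  using bilinear_ip(5)[of 0] bilinear_ip(6)[of _ 0] by simp_all

lemma ip_sum_left: "ip (\<Sum>i\<in>A. f i) z = (\<Sum>i\<in>A. ip (f i) z)"
  by (simp add: ip_def inner_sum_left)

lemma ip_self_nonneg [simp]: "0 \<le> ip x x"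
  using pd by (cases "x = 0") (auto simp: ip_def positive_definite_operator_def less_imp_le)

lemma ip_self_pos: "x \<noteq> 0 \<Longrightarrow> 0 < ip x x"
  using pd by (auto simp: ip_def positive_definite_operator_def)

lemma norm_wrt_eq: "norm_wrt M x = sqrt (ip x x)"
  by (simp add: norm_wrt_def ip_def)

lemma norm_wrt_sq: "(norm_wrt M x)\<^sup>2 = ip x x"
  by (simp add: norm_wrt_eq)

lemma norm_wrt_nonneg [simp]: "0 \<le> norm_wrt M x"
  by (simp add: norm_wrt_eq)

lemma norm_wrt_0 [simp]: "norm_wrt M 0 = 0"
  by (simp add: norm_wrt_eq)

lemma norm_wrt_eq_0 [simp]: "norm_wrt M x = 0 \<longleftrightarrow> x = 0"
  using ip_self_pos[of x] by (cases "x = 0") (auto simp: norm_wrt_eq)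

lemma norm_wrt_scaleR: "norm_wrt M (c *\<^sub>R x) = \<bar>c\<bar> * norm_wrt M x"
  by (simp add: norm_wrt_eq bilinear_ip real_sqrt_mult flip: mult.assoc)

lemma norm_wrt_minus_commute: "norm_wrt M (x - y) = norm_wrt M (y - x)"
  using norm_wrt_scaleR[of "-1" "x - y"] by simp

lemma ip_sq_diff: "ip (x - y) (x - y) = ip x x - 2 * ip x y + ip y y"
  by (simp add: bilinear_ip ip_commute[of y x])

lemma ip_sq_add: "ip (x + y) (x + y) = ip x x + 2 * ip x y + ip y y"
  by (simp add: bilinear_ip ip_commute[of y x])

lemma ip_le_norms: "ip x y \<le> norm_wrt M x * norm_wrt M y"
proof (cases "x = 0 \<or> y = 0")
  case False
  define a b where "a = norm_wrt M x" and "b = norm_wrt M y"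
  have ab: "a > 0" "b > 0"
    using False norm_wrt_nonneg[of x] norm_wrt_nonneg[of y] norm_wrt_eq_0[of x] norm_wrt_eq_0[of y]
    unfolding a_def b_def by linarith+
  have "0 \<le> ip (b *\<^sub>R x - a *\<^sub>R y) (b *\<^sub>R x - a *\<^sub>R y)" by simp
  also have "\<dots> = b\<^sup>2 * ip x x - 2 * (a * b) * ip x y + a\<^sup>2 * ip y y"
    by (simp add: ip_sq_diff) (simp add: bilinear_ip power2_eq_square)
  also have "\<dots> = 2 * (a * b) * (a * b - ip x y)"
    by (simp add: a_def b_def norm_wrt_sq[symmetric] power2_eq_square algebra_simps)
  finally have "0 \<le> 2 * (a * b) * (a * b - ip x y)" .
  moreover have "0 < 2 * (a * b)" using ab by simp
  ultimately have "0 \<le> a * b - ip x y" by (metis zero_le_mult_iff not_less)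
  then show ?thesis by (simp add: a_def b_def)
qed (auto simp: norm_wrt_eq)

lemma norm_wrt_triangle: "norm_wrt M (x + y) \<le> norm_wrt M x + norm_wrt M y"
proof (rule power2_le_imp_le)
  show "(norm_wrt M (x + y))\<^sup>2 \<le> (norm_wrt M x + norm_wrt M y)\<^sup>2"
    using ip_le_norms[of x y] by (simp add: norm_wrt_sq ip_sq_add power2_sum)
qed simp

lemma ip_young:
  assumes "0 < t"
  shows "2 * ip x y \<le> t * ip x x + ip y y / t"
proof -
  have "0 \<le> ip (t *\<^sub>R x - y) (t *\<^sub>R x - y) / t" using assms by simp
  also have "\<dots> = t * ip x x - 2 * ip x y + ip y y / t"
    using assms by (simp add: ip_sq_diff) (simp add: bilinear_ip field_simps)
  finally show ?thesis by simp
qed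

lemma norm_wrt_le_norm: obtains c where "c > 0" "\<And>x. norm_wrt M x \<le> c * norm x"
proof -
  obtain K where K: "K > 0" "\<And>x. norm (M x) \<le> norm x * K"
    using bounded_linear.pos_bounded[OF bounded_linear_M] by blast
  have "norm_wrt M x \<le> sqrt K * norm x" for x
  proof -
    have "ip x x \<le> norm x * norm (M x)" unfolding ip_def by (rule norm_cauchy_schwarz)
    also have "\<dots> \<le> norm x * (norm x * K)" by (intro mult_left_mono K) simp
    finally have "ip x x \<le> K * (norm x)\<^sup>2" by (simp add: power2_eq_square mult_ac)
    then have "sqrt (ip x x) \<le> sqrt (K * (norm x)\<^sup>2)" by (rule real_sqrt_le_mono)
    then show ?thesis by (simp add: norm_wrt_eq real_sqrt_mult)
  qed
  then show thesis using that[of "sqrt K"] K by simp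
qed

lemma continuous_on_ip [continuous_intros]:
  fixes f g :: "'b::topological_space \<Rightarrow> 'a"
  assumes "continuous_on S f" "continuous_on S g"
  shows "continuous_on S (\<lambda>z. ip (f z) (g z))"
  unfolding ip_def
  by (intro continuous_intros assms bounded_linear.continuous_on[OF bounded_linear_M])

lemma continuous_on_norm_wrt [continuous_intros]:
  fixes f :: "'b::topological_space \<Rightarrow> 'a"
  assumes "continuous_on S f"
  shows "continuous_on S (\<lambda>z. norm_wrt M (f z))"
  unfolding norm_wrt_eq by (intro continuous_intros assms)

section \<open>Equivalence of the two norms\<close>

lemma Metric_space_norm_wrt: "Metric_space UNIV (\<lambda>x y. norm_wrt M (x - y))"
proof
  show "norm_wrt M (x - z) \<le> norm_wrt M (x - y) + norm_wrt M (y - z)" for x y z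
    using norm_wrt_triangle[of "x - y" "y - z"] by simp
qed (auto simp: norm_wrt_minus_commute)

text \<open>
  Baire category, in the complete \<open>M\<close>-metric, applied to the \<open>M\<close>-closures of the balls of the original
  norm: one of them has interior, so by symmetry and scaling every vector is an \<open>M\<close>-limit of vectors
  whose original norm is controlled by its \<open>M\<close>-norm.
\<close>

lemma approximately_open:
  assumes "complete_wrt M"
  obtains K where "K \<ge> 0" "\<And>y e. e > 0 \<Longrightarrow> \<exists>b. norm b \<le> K * norm_wrt M y \<and> norm_wrt M (y - b) < e"
proof -
  interpret W: Metric_space UNIV "\<lambda>x y. norm_wrt M (x - y)" by (rule Metric_space_norm_wrt)
  define F where "F n = W.mtopology closure_of (cball 0 (real n))" for n
  have F: "x \<in> F n \<longleftrightarrow> (\<forall>r>0. \<exists>b. norm b \<le> real n \<and> norm_wrt M (x - b) < r)" for x n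
    by (simp add: F_def W.metric_closure_of Bex_def)
  have "(\<Union>n. F n) = UNIV"
  proof -
    have "x \<in> F (nat \<lceil>norm x\<rceil>)" for x
      unfolding F by (intro allI impI exI[of _ x]) (auto simp: of_nat_ceiling)
    then show ?thesis by blast
  qed
  moreover have "W.mtopology interior_of UNIV = UNIV"
    using interior_of_topspace[of W.mtopology] by simp
  ultimately have "W.mtopology interior_of \<Union>(range F) \<noteq> {}" by simp
  moreover have "W.mtopology interior_of \<Union>(range F) = {}"
    if "\<And>n. W.mtopology interior_of (F n) = {}"
    using assms that by (intro W.metric_Baire_category_alt) (auto simp: complete_wrt_def F_def)
  ultimately obtain n where "W.mtopology interior_of (F n) \<noteq> {}" by blast
  then obtain a where a: "a \<in> W.mtopology interior_of (F n)" by auto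
  then obtain r where r: "r > 0" "W.mball a r \<subseteq> W.mtopology interior_of (F n)"
    using openin_interior_of[of W.mtopology "F n"] unfolding W.openin_mtopology by blast
  have ball: "x \<in> F n" if "norm_wrt M (a - x) < r" for x
    using that r(2) interior_of_subset[of W.mtopology "F n"] by (auto simp: W.in_mball)
  have small: "\<exists>b. norm b \<le> 2 * real n \<and> norm_wrt M (y - b) < e"
    if y: "norm_wrt M y < r" and e: "e > 0" for y e
  proof -
    \<comment> \<open>A vector in the shifted ball is a difference of two vectors in the closure of the same ball.\<close>
    have "norm_wrt M (a - (a + y)) < r" using y norm_wrt_minus_commute[of 0 y] by simp
    then have "a + y \<in> F n" "a \<in> F n" using ball r(1) by (auto simp: norm_wrt_eq)
    then obtain b c where b: "norm b \<le> real n" "norm_wrt M (a + y - b) < e / 2"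
      and c: "norm c \<le> real n" "norm_wrt M (a - c) < e / 2"
      unfolding F using e by (meson half_gt_zero)
    have "norm (b - c) \<le> 2 * real n" using norm_triangle_ineq4[of b c] b c by simp
    moreover have "norm_wrt M (y - (b - c)) < e"
      using norm_wrt_triangle[of "a + y - b" "c - a"] b c norm_wrt_minus_commute[of a c]
      by (simp add: algebra_simps)
    ultimately show ?thesis by blast
  qed
  define K where "K = 4 * real n / r"
  show thesis
  proof (rule that[of K])
    show "K \<ge> 0" using r by (simp add: K_def)
    fix y :: 'a and e :: real
    assume e: "e > 0"
    show "\<exists>b. norm b \<le> K * norm_wrt M y \<and> norm_wrt M (y - b) < e"
    proof (cases "y = 0")
      case True
      then show ?thesis using e by (intro exI[of _ 0]) (simp add: norm_wrt_eq)
    next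
      case False
      define t where "t = 2 * norm_wrt M y / r"
      have ny: "norm_wrt M y > 0" using False norm_wrt_nonneg[of y] norm_wrt_eq_0[of y] by linarith
      then have t: "t > 0" using r by (simp add: t_def)
      have "norm_wrt M ((1 / t) *\<^sub>R y) < r" using t ny r by (simp add: norm_wrt_scaleR t_def)
      then obtain b where b: "norm b \<le> 2 * real n" "norm_wrt M ((1 / t) *\<^sub>R y - b) < e / t"
        using small[of "(1 / t) *\<^sub>R y" "e / t"] e t by auto
      have "y - t *\<^sub>R b = t *\<^sub>R ((1 / t) *\<^sub>R y - b)" using t by (simp add: algebra_simps)
      then have "norm_wrt M (y - t *\<^sub>R b) = t * norm_wrt M ((1 / t) *\<^sub>R y - b)"
        using t by (simp add: norm_wrt_scaleR)
      also have "\<dots> < e" using b(2) t by (simp add: field_simps)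
      finally have "norm_wrt M (y - t *\<^sub>R b) < e" .
      moreover have "norm (t *\<^sub>R b) \<le> K * norm_wrt M y"
      proof -
        have "norm (t *\<^sub>R b) \<le> t * (2 * real n)" using t b by simp
        also have "\<dots> = K * norm_wrt M y" using r by (simp add: t_def K_def)
        finally show ?thesis .
      qed
      ultimately show ?thesis by blast
    qed
  qed
qed

text \<open>
  The second half of the open mapping theorem: approximate \<open>y\<close> up to half of its \<open>M\<close>-norm, then the
  remainder, and so on. The corrections form a geometric series in the original norm, whose
  completeness provides the sum; as the \<open>M\<close>-norm is dominated by the original one, the sum is \<open>y\<close>.
\<close>

lemma norm_le_norm_wrt:
  assumes "complete_wrt M"
  obtains K where "K > 0" "\<And>x. norm x \<le> K * norm_wrt M x"
proof -
  obtain c where c: "c > 0" "\<And>x. norm_wrt M x \<le> c * norm x" using norm_wrt_le_norm by blast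
  obtain K where K: "K \<ge> 0"
    and approx: "\<And>y e. e > 0 \<Longrightarrow> \<exists>b. norm b \<le> K * norm_wrt M y \<and> norm_wrt M (y - b) < e"
    using approximately_open[OF assms] by blast
  have "\<exists>b. norm b \<le> K * norm_wrt M y \<and> norm_wrt M (y - b) \<le> norm_wrt M y / 2" for y
  proof (cases "y = 0")
    case False
    then have "norm_wrt M y / 2 > 0" using norm_wrt_nonneg[of y] norm_wrt_eq_0[of y] by linarith
    from approx[OF this] show ?thesis by (meson less_imp_le)
  qed (auto intro!: exI[of _ 0])
  then obtain b where b: "\<And>y. norm (b y) \<le> K * norm_wrt M y"
      "\<And>y. norm_wrt M (y - b y) \<le> norm_wrt M y / 2" by metis
  have bound: "norm y \<le> 2 * K * norm_wrt M y" for y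
  proof -
    define r where "r n = ((\<lambda>z. z - b z) ^^ n) y" for n
    have rSuc: "r (Suc n) = r n - b (r n)" for n by (simp add: r_def)
    have r_le: "norm_wrt M (r n) \<le> norm_wrt M y * (1 / 2) ^ n" for n
    proof (induction n)
      case (Suc n)
      then show ?case using b(2)[of "r n"] by (simp add: rSuc)
    qed (simp add: r_def)
    define C where "C = K * norm_wrt M y"
    have C: "C \<ge> 0" using K by (simp add: C_def)
    have incr: "norm (r n - r (Suc n)) \<le> C * (1 / 2) ^ n" for n
      using b(1)[of "r n"] mult_left_mono[OF r_le[of n] K] by (simp add: rSuc C_def mult.assoc)
    \<comment> \<open>The second term makes the estimate telescope in the induction on n.\<close>
    have gap: "norm (r m - r (m + n)) \<le> 2 * C * (1 / 2) ^ m - 2 * C * (1 / 2) ^ (m + n)" for m n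
    proof (induction n)
      case (Suc n)
      have "norm (r m - r (m + Suc n)) \<le> norm (r m - r (m + n)) + norm (r (m + n) - r (Suc (m + n)))"
        using norm_triangle_ineq[of "r m - r (m + n)" "r (m + n) - r (Suc (m + n))"] by simp
      then show ?case using Suc incr[of "m + n"] by simp
    qed simp
    have tail: "norm (r m - r n) \<le> 2 * C * (1 / 2) ^ m" if "m \<le> n" for m n
    proof -
      have "0 \<le> 2 * C * (1 / 2) ^ n" using C by simp
      then show ?thesis using gap[of m "n - m"] that by simp
    qed
    have "Cauchy r"
    proof (rule metric_CauchyI)
      fix e :: real
      assume "e > 0"
      moreover have "(\<lambda>m. 2 * C * (1 / 2) ^ m) \<longlonglongrightarrow> 2 * C * 0"
        by (intro tendsto_intros LIMSEQ_power_zero) simp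
      ultimately have "\<forall>\<^sub>F m in sequentially. 2 * C * (1 / 2) ^ m < e"
        by (intro order_tendstoD(2)) auto
      then obtain N where N: "\<And>m. m \<ge> N \<Longrightarrow> 2 * C * (1 / 2) ^ m < e"
        by (auto simp: eventually_sequentially)
      have "dist (r m) (r n) < e" if "m \<ge> N" "n \<ge> N" for m n
      proof (cases "m \<le> n")
        case True
        then show ?thesis using tail[of m n] N[of m] that by (simp add: dist_norm)
      next
        case False
        then show ?thesis using tail[of n m] N[of n] that by (simp add: dist_norm norm_minus_commute)
      qed
      then show "\<exists>N. \<forall>m\<ge>N. \<forall>n\<ge>N. dist (r m) (r n) < e" by blast
    qed
    then obtain l where l: "r \<longlonglongrightarrow> l" using Cauchy_convergent convergent_def by blast
    define s where "s = y - l"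
    have lim: "(\<lambda>n. y - r n) \<longlonglongrightarrow> s" unfolding s_def by (intro tendsto_intros l)
    have "norm_wrt M (y - s) \<le> norm_wrt M y * (1 / 2) ^ n + c * norm (y - r n - s)" for n
      using norm_wrt_triangle[of "r n" "y - r n - s"] r_le[of n] c(2)[of "y - r n - s"] by simp
    moreover have "(\<lambda>n. norm_wrt M y * (1 / 2) ^ n + c * norm (y - r n - s)) \<longlonglongrightarrow>
        norm_wrt M y * 0 + c * norm (s - s)"
      by (intro tendsto_intros lim LIMSEQ_power_zero) simp
    ultimately have "norm_wrt M (y - s) \<le> norm_wrt M y * 0 + c * norm (s - s)"
      by (intro LIMSEQ_le_const) auto
    then have "norm_wrt M (y - s) = 0" using norm_wrt_nonneg[of "y - s"] by simp
    then have "y = s" by simp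
    also have "norm s \<le> 2 * C"
    proof (rule LIMSEQ_le_const2[OF tendsto_norm[OF lim]])
      have "norm (y - r n) \<le> 2 * C" for n using tail[of 0 n] by (simp add: r_def)
      then show "\<exists>N. \<forall>n\<ge>N. norm (y - r n) \<le> 2 * C" by blast
    qed
    finally show ?thesis by (simp add: C_def)
  qed
  show thesis
  proof (rule that[of "2 * K + 1"])
    show "norm x \<le> (2 * K + 1) * norm_wrt M x" for x
      using add_increasing2[OF norm_wrt_nonneg bound, of x x] by (simp add: distrib_right)
  qed (use K in simp)
qed

end

section \<open>Blocks and selections\<close>

lemma linear_block:
  assumes H: "hilbert_direct_sum H"
  shows "linear (block H i)"
proof -
  have sub: "subspace (H j)" for j using H by (simp add: hilbert_direct_sum_def)
  have mem: "block H j x \<in> H j" for j x by (rule block_decomposition(1)[OF H])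
  have total: "(\<Sum>j\<in>UNIV. block H j x) = x" for x
    by (rule block_decomposition(2)[OF H, symmetric])
  have "(\<lambda>j. block H j (x + y)) = (\<lambda>j. block H j x + block H j y)" for x y
    by (intro orthogonal_sum_unique[OF H] mem subspace_add sub) (simp add: sum.distrib total)
  moreover have "(\<lambda>j. block H j (c *\<^sub>R x)) = (\<lambda>j. c *\<^sub>R block H j x)" for c x
    by (intro orthogonal_sum_unique[OF H] mem subspace_scale sub)
      (simp add: total flip: scaleR_sum_right)
  ultimately show ?thesis by (intro linearI) (meson fun_cong)+
qed

lemma norm_block_le:
  assumes H: "hilbert_direct_sum H"
  shows "norm (block H i x) \<le> norm x"
proof -
  have "inner (block H i x) (block H i x) \<le> (\<Sum>j\<in>UNIV. inner (block H j x) (block H j x))"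
    by (rule member_le_sum) auto
  then show ?thesis by (simp add: norm_eq_sqrt_inner inner_eq_sum_block[OF H, of x x])
qed

lemma bounded_linear_block:
  assumes "hilbert_direct_sum H"
  shows "bounded_linear (block H i)"
  using linear_block[OF assms, of i] norm_block_le[OF assms, of i]
  by (intro bounded_linear_intro[where K = 1]) (auto simp: linear_add linear_cmul)

lemma continuous_on_vec_sel [continuous_intros]:
  assumes "hilbert_direct_sum H" "continuous_on S f" "continuous_on S g"
  shows "continuous_on S (\<lambda>z. vec_sel H (f z) (g z))"
  unfolding vec_sel_def
  by (intro continuous_intros assms bounded_linear.continuous_on[OF bounded_linear_block])

lemma T_sel_eq:
  assumes "hilbert_direct_sum H" "\<theta> \<noteq> 0"
  shows "T_sel H \<theta> T s x = x - vec_sel H (x - T x) s"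
  using assms
  by (simp add: T_sel_def S_sel_def S_block_def S_op_def vec_sel_def linear_cmul[OF linear_block]
      scaleR_sum_right mult.left_commute[of \<theta>])

section \<open>One step of the iteration in expectation\<close>

text \<open>
  The distribution \<open>\<mu>\<close> of a single selection. No probability space of trajectories is involved yet: the
  integrals over \<open>\<mu>\<close> below are the conditional expectations given the current iterate.
\<close>

locale random_block_step = positive_definite M
  for M :: "'a::{real_inner,complete_space} \<Rightarrow> 'a" +
  fixes H :: "'m::finite \<Rightarrow> 'a set" and T :: "'a \<Rightarrow> 'a"
    and \<theta> \<alpha> \<beta> :: real and \<mu> :: "(real^'m) measure"
  assumes complete: "complete_wrt M" and nontrivial: "\<exists>u::'a. u \<noteq> 0"
    and direct_sum: "hilbert_direct_sum H"
    and theta: "0 < \<theta>" and averaged: "averaged M \<theta> T"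
    and prob_mu: "prob_space \<mu>" and sets_mu: "sets \<mu> = sets borel"
    and AE_mu: "AE s in \<mu>. s \<in> cbox 0 1"
    and alpha: "0 < \<alpha>" and mean: "(\<integral>s. s \<partial>\<mu>) = \<alpha> *\<^sub>R 1"
    and beta: "\<beta> < \<alpha> / \<theta>"
    and second_moment: "\<And>u. (\<integral>s. (norm_wrt M (vec_sel H u s))\<^sup>2 \<partial>\<mu>) \<le> \<beta> * (norm_wrt M u)\<^sup>2"
begin

abbreviation R :: "'a \<Rightarrow> 'a" where "R x \<equiv> x - T x"

abbreviation step :: "real^'m \<Rightarrow> 'a \<Rightarrow> 'a" where "step \<equiv> T_sel H \<theta> T"

lemma step_eq: "step s x = x - vec_sel H (R x) s"
  using theta by (simp add: T_sel_eq[OF direct_sum])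

text \<open>
  \<open>R = \<theta> (Id - C)\<close> with \<open>C\<close> nonexpansive, and \<open>|d - e|\<^sup>2 \<le> 2 \<langle>d - e, d\<rangle>\<close> whenever \<open>|e| \<le> |d|\<close>.
\<close>

lemma R_cocoercive: "ip (R x - R y) (R x - R y) \<le> 2 * \<theta> * ip (R x - R y) (x - y)"
proof -
  obtain C where C: "\<And>x y. norm_wrt M (C x - C y) \<le> norm_wrt M (x - y)"
      "\<And>x. T x = (1 - \<theta>) *\<^sub>R x + \<theta> *\<^sub>R C x"
    using averaged by (auto simp: averaged_def)
  define d e where "d = x - y" and "e = C x - C y"
  have R: "R x - R y = \<theta> *\<^sub>R (d - e)" by (simp add: C(2) d_def e_def algebra_simps)
  have "ip e e \<le> ip d d"
    using power_mono[OF C(1)[of x y], of 2] by (simp add: norm_wrt_sq d_def e_def)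
  then have "ip (d - e) (d - e) \<le> 2 * ip (d - e) d"
    by (simp add: ip_sq_diff) (simp add: bilinear_ip ip_commute)
  then have "\<theta>\<^sup>2 * ip (d - e) (d - e) \<le> \<theta>\<^sup>2 * (2 * ip (d - e) d)"
    by (rule mult_left_mono) simp
  then show ?thesis
    unfolding R d_def[symmetric] by (simp add: bilinear_ip(5,6) power2_eq_square mult_ac)
qed

lemma R_lipschitz: "norm_wrt M (R x - R y) \<le> 2 * \<theta> * norm_wrt M (x - y)"
proof (cases "norm_wrt M (R x - R y) = 0")
  case False
  then have pos: "norm_wrt M (R x - R y) > 0" using norm_wrt_nonneg[of "R x - R y"] by linarith
  have "norm_wrt M (R x - R y) * norm_wrt M (R x - R y) = ip (R x - R y) (R x - R y)"
    by (simp add: norm_wrt_sq flip: power2_eq_square)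
  also have "\<dots> \<le> 2 * \<theta> * ip (R x - R y) (x - y)" by (rule R_cocoercive)
  also have "\<dots> \<le> 2 * \<theta> * (norm_wrt M (R x - R y) * norm_wrt M (x - y))"
    using theta by (intro mult_left_mono ip_le_norms) auto
  also have "\<dots> = norm_wrt M (R x - R y) * (2 * \<theta> * norm_wrt M (x - y))" by simp
  finally show ?thesis using pos by (rule mult_left_le_imp_le)
qed (use theta in simp)

lemma continuous_on_R: "continuous_on UNIV R"
proof -
  obtain K where K: "K > 0" "\<And>x. norm x \<le> K * norm_wrt M x"
    using norm_le_norm_wrt[OF complete] by blast
  obtain c where c: "c > 0" "\<And>x. norm_wrt M x \<le> c * norm x"
    using norm_wrt_le_norm by blast
  have "dist (R x) (R y) \<le> K * (2 * \<theta> * c) * dist x y" for x y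
  proof -
    have "dist (R x) (R y) \<le> K * norm_wrt M (R x - R y)" using K(2) by (simp add: dist_norm)
    also have "\<dots> \<le> K * (2 * \<theta> * norm_wrt M (x - y))"
      using K(1) by (intro mult_left_mono R_lipschitz) simp
    also have "\<dots> \<le> K * (2 * \<theta> * (c * norm (x - y)))"
      using K(1) theta by (intro mult_left_mono c) simp_all
    finally show ?thesis by (simp add: dist_norm mult.assoc)
  qed
  then have "(K * (2 * \<theta> * c))-lipschitz_on UNIV R"
    using K(1) theta c(1) by (intro lipschitz_onI) auto
  then show ?thesis by (rule lipschitz_on_continuous_on)
qed

lemma continuous_on_step:
  assumes "continuous_on S f" "continuous_on S g"
  shows "continuous_on S (\<lambda>z. step (f z) (g z))"
  unfolding step_eq
  by (intro continuous_intros direct_sum assms continuous_on_compose2[OF continuous_on_R assms(2)])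
    auto

lemma integrable_continuous:
  fixes f :: "real^'m \<Rightarrow> 'b::{banach, second_countable_topology}"
  assumes "continuous_on UNIV f"
  shows "integrable \<mu> f"
proof -
  interpret prob_space \<mu> by (rule prob_mu)
  have "compact (f ` cbox 0 1)"
    by (intro compact_continuous_image continuous_on_subset[OF assms]) auto
  then obtain B where B: "\<And>s. s \<in> cbox 0 1 \<Longrightarrow> norm (f s) \<le> B"
    by (meson bounded_iff compact_imp_bounded imageI)
  show ?thesis
  proof (rule integrable_const_bound)
    show "AE s in \<mu>. norm (f s) \<le> B" using AE_mu by eventually_elim (rule B)
    show "f \<in> borel_measurable \<mu>"
      using borel_measurable_continuous_onI[OF assms] sets_mu measurable_cong_sets by blast
  qed
qed

lemma integral_component: "(\<integral>s. s $ i \<partial>\<mu>) = \<alpha>"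
proof -
  have "(\<integral>s. s $ i \<partial>\<mu>) = (\<integral>s. s \<partial>\<mu>) $ i"
    by (rule integral_bounded_linear[OF bounded_linear_vec_nth])
      (intro integrable_continuous continuous_intros)
  then show ?thesis by (simp add: mean)
qed

lemma integral_ip_vec_sel: "(\<integral>s. ip (vec_sel H u s) y \<partial>\<mu>) = \<alpha> * ip u y"
proof -
  have "(\<integral>s. ip (vec_sel H u s) y \<partial>\<mu>) = (\<integral>s. (\<Sum>i\<in>UNIV. s $ i * ip (block H i u) y) \<partial>\<mu>)"
    by (simp add: vec_sel_def ip_sum_left bilinear_ip)
  also have "\<dots> = (\<Sum>i\<in>UNIV. \<integral>s. s $ i * ip (block H i u) y \<partial>\<mu>)"
    by (intro Bochner_Integration.integral_sum integrable_continuous continuous_intros)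
  also have "\<dots> = (\<Sum>i\<in>UNIV. \<alpha> * ip (block H i u) y)"
    by (simp add: integral_component)
  also have "\<dots> = \<alpha> * ip (\<Sum>i\<in>UNIV. block H i u) y"
    by (simp add: ip_sum_left sum_distrib_left)
  finally show ?thesis by (simp flip: block_decomposition(2)[OF direct_sum])
qed

lemma integral_sq_diff_vec_sel:
  "(\<integral>s. ip (p - vec_sel H u s) (p - vec_sel H u s) \<partial>\<mu>)
    = ip p p - 2 * \<alpha> * ip u p + (\<integral>s. ip (vec_sel H u s) (vec_sel H u s) \<partial>\<mu>)"
proof -
  interpret prob_space \<mu> by (rule prob_mu)
  have int: "integrable \<mu> (\<lambda>s. ip (vec_sel H u s) p)"
    "integrable \<mu> (\<lambda>s. ip (vec_sel H u s) (vec_sel H u s))"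
    by (intro integrable_continuous continuous_intros direct_sum)+
  have "ip (p - vec_sel H u s) (p - vec_sel H u s)
      = ip p p - 2 * ip (vec_sel H u s) p + ip (vec_sel H u s) (vec_sel H u s)" for s
    by (simp add: ip_sq_diff ip_commute)
  then show ?thesis using int by (simp add: integral_ip_vec_sel prob_space)
qed

text \<open>
  Jensen's inequality for \<open>u\<^sub>s\<close>, whose mean is \<open>\<alpha> u\<close>; the space must contain some \<open>u \<noteq> 0\<close>.
\<close>

lemma alpha_sq_le_beta: "\<alpha>\<^sup>2 \<le> \<beta>"
proof -
  obtain u :: 'a where u: "u \<noteq> 0" using nontrivial by blast
  have "0 \<le> (\<integral>s. ip (\<alpha> *\<^sub>R u - vec_sel H u s) (\<alpha> *\<^sub>R u - vec_sel H u s) \<partial>\<mu>)"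
    by (rule Bochner_Integration.integral_nonneg) simp
  also have "\<dots> \<le> \<alpha>\<^sup>2 * ip u u - 2 * \<alpha>\<^sup>2 * ip u u + \<beta> * ip u u"
    using second_moment[of u] unfolding norm_wrt_sq integral_sq_diff_vec_sel
    by (simp add: bilinear_ip(5,6) power2_eq_square mult.assoc)
  finally have "0 \<le> (\<beta> - \<alpha>\<^sup>2) * ip u u" by (simp add: algebra_simps)
  then show ?thesis using ip_self_pos[OF u] by (simp add: zero_le_mult_iff)
qed

text \<open>
  This strict inequality makes the reference map a strictly averaged one, which is what forces its
  displacements to become asymptotically constant.
\<close>

lemma alpha_theta_less_1: "\<alpha> * \<theta> < 1"
proof -
  have "\<alpha>\<^sup>2 < \<alpha> / \<theta>" using alpha_sq_le_beta beta by simp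
  then have "\<alpha> * (\<alpha> * \<theta>) < \<alpha> * 1" using theta by (simp add: field_simps power2_eq_square)
  then show ?thesis using alpha by (simp only: mult_less_cancel_left_pos)
qed

text \<open>
  The weight \<open>-(\<alpha>/\<theta> - \<beta>)\<close> results from \<open>-2 \<alpha> \<langle>h, d\<rangle> \<le> -(\<alpha>/\<theta>) |h|\<^sup>2\<close> (cocoercivity) and from the
  contribution \<open>\<beta> |h|\<^sup>2\<close> of the second moment of \<open>(h + w)\<^sub>s\<close>.
\<close>

lemma integral_sq_step:
  "(\<integral>s. ip (step s x - (z - \<alpha> *\<^sub>R R z)) (step s x - (z - \<alpha> *\<^sub>R R z)) \<partial>\<mu>)
    \<le> ip (x - z) (x - z) - (\<alpha> / \<theta> - \<beta>) * ip (R x - R z) (R x - R z)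
      + 2 * (\<beta> - \<alpha>\<^sup>2) * ip (R x - R z) (R z) + (\<beta> - \<alpha>\<^sup>2) * ip (R z) (R z)"
    (is "?L \<le> ?B")
proof -
  define d r w h where "d = x - z" and "r = R x" and "w = R z" and "h = r - w"
  have r: "r = h + w" by (simp add: h_def)
  define p where "p = d + \<alpha> *\<^sub>R w"
  have eq: "step s x - (z - \<alpha> *\<^sub>R R z) = p - vec_sel H r s" for s
    by (simp add: step_eq p_def d_def r_def w_def algebra_simps)
  have "?L \<le> ip p p - 2 * \<alpha> * ip r p + \<beta> * ip r r"
    using second_moment[of r] unfolding eq integral_sq_diff_vec_sel by (simp add: norm_wrt_sq)
  also have "\<dots> = ip d d - 2 * \<alpha> * ip h d + \<beta> * ip h h + 2 * (\<beta> - \<alpha>\<^sup>2) * ip h w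
      + (\<beta> - \<alpha>\<^sup>2) * ip w w"
    unfolding p_def r by (simp add: bilinear_ip ip_commute algebra_simps power2_eq_square)
  also have "\<dots> \<le> ip d d - (\<alpha> / \<theta> - \<beta>) * ip h h + 2 * (\<beta> - \<alpha>\<^sup>2) * ip h w + (\<beta> - \<alpha>\<^sup>2) * ip w w"
  proof -
    have "\<alpha> / \<theta> * ip h h \<le> \<alpha> / \<theta> * (2 * \<theta> * ip h d)"
      unfolding h_def r_def w_def d_def using alpha theta
      by (intro mult_left_mono R_cocoercive) simp
    then show ?thesis using theta by (simp add: algebra_simps)
  qed
  finally show ?thesis by (simp add: d_def h_def r_def w_def)
qed

lemma integral_ip_step:
  "(\<integral>s. ip (step s x - (z - \<alpha> *\<^sub>R R z)) y \<partial>\<mu>) = ip (x - z) y - \<alpha> * ip (R x - R z) y"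
proof -
  interpret prob_space \<mu> by (rule prob_mu)
  have eq: "ip (step s x - (z - \<alpha> *\<^sub>R R z)) y
      = ip (x - z + \<alpha> *\<^sub>R R z) y - ip (vec_sel H (R x) s) y" for s
    by (simp add: step_eq bilinear_ip)
  have "integrable \<mu> (\<lambda>s. ip (vec_sel H (R x) s) y)"
    by (intro integrable_continuous continuous_intros direct_sum)
  then show ?thesis
    unfolding eq by (simp add: integral_ip_vec_sel prob_space) (simp add: bilinear_ip algebra_simps)
qed

text \<open>
  The factor for which the mean change \<open>-\<alpha> \<langle>h, w\<rangle>\<close> of \<open>\<langle>d, w\<rangle>\<close> cancels the cross term of
  \<open>integral_sq_step\<close>.
\<close>

definition \<kappa> :: real where "\<kappa> = (\<beta> - \<alpha>\<^sup>2) / \<alpha>"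

definition lyap :: "'a \<Rightarrow> 'a \<Rightarrow> 'a \<Rightarrow> real" where
  "lyap z w x = ip (x - z) (x - z) + 2 * \<kappa> * ip (x - z) w"

lemma integral_lyap_step:
  "(\<integral>s. lyap (z - \<alpha> *\<^sub>R R z) (R z) (step s x) \<partial>\<mu>) \<le> lyap z (R z) x + (\<beta> - \<alpha>\<^sup>2) * ip (R z) (R z)"
proof -
  have "(\<integral>s. lyap (z - \<alpha> *\<^sub>R R z) (R z) (step s x) \<partial>\<mu>)
    = (\<integral>s. ip (step s x - (z - \<alpha> *\<^sub>R R z)) (step s x - (z - \<alpha> *\<^sub>R R z)) \<partial>\<mu>)
      + 2 * \<kappa> * (\<integral>s. ip (step s x - (z - \<alpha> *\<^sub>R R z)) (R z) \<partial>\<mu>)"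
    unfolding lyap_def
    by (subst Bochner_Integration.integral_add)
      (auto intro!: integrable_continuous continuous_intros continuous_on_step)
  also have "\<dots> \<le> ip (x - z) (x - z) - (\<alpha> / \<theta> - \<beta>) * ip (R x - R z) (R x - R z)
      + 2 * (\<beta> - \<alpha>\<^sup>2) * ip (R x - R z) (R z) + (\<beta> - \<alpha>\<^sup>2) * ip (R z) (R z)
      + 2 * \<kappa> * (ip (x - z) (R z) - \<alpha> * ip (R x - R z) (R z))"
    using integral_sq_step[of x z] by (simp add: integral_ip_step)
  also have "\<dots> = lyap z (R z) x + (\<beta> - \<alpha>\<^sup>2) * ip (R z) (R z)
      - (\<alpha> / \<theta> - \<beta>) * ip (R x - R z) (R x - R z)"
  proof -
    have "\<beta> - \<alpha>\<^sup>2 = \<kappa> * \<alpha>" using alpha by (simp add: \<kappa>_def)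
    then show ?thesis unfolding lyap_def by (simp only:) (simp add: algebra_simps)
  qed
  also have "\<dots> \<le> lyap z (R z) x + (\<beta> - \<alpha>\<^sup>2) * ip (R z) (R z)"
    using beta by simp
  finally show ?thesis .
qed

text \<open>
  Growth rate obtained when the cross term is instead absorbed, by Young's inequality, into
  the negative multiple of \<open>|h|\<^sup>2\<close>. It is too large for the final bound, but it shows that the mean square deviation
  grows at most linearly, which controls the error terms.
\<close>

definition drift :: real where "drift = (\<beta> - \<alpha>\<^sup>2)\<^sup>2 / (\<alpha> / \<theta> - \<beta>) + (\<beta> - \<alpha>\<^sup>2)"

lemma drift_nonneg: "0 \<le> drift"
  using alpha_sq_le_beta beta by (simp add: drift_def)

lemma integral_sq_step_crude:
  "(\<integral>s. ip (step s x - (z - \<alpha> *\<^sub>R R z)) (step s x - (z - \<alpha> *\<^sub>R R z)) \<partial>\<mu>)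
    \<le> ip (x - z) (x - z) + drift * ip (R z) (R z)"
proof -
  define h w where "h = R x - R z" and "w = R z"
  have "2 * ip h ((\<beta> - \<alpha>\<^sup>2) *\<^sub>R w) \<le> (\<alpha> / \<theta> - \<beta>) * ip h h
      + ip ((\<beta> - \<alpha>\<^sup>2) *\<^sub>R w) ((\<beta> - \<alpha>\<^sup>2) *\<^sub>R w) / (\<alpha> / \<theta> - \<beta>)"
    using beta by (intro ip_young) simp
  then have "2 * (\<beta> - \<alpha>\<^sup>2) * ip h w
      \<le> (\<alpha> / \<theta> - \<beta>) * ip h h + (\<beta> - \<alpha>\<^sup>2)\<^sup>2 / (\<alpha> / \<theta> - \<beta>) * ip w w"
    by (simp only: bilinear_ip(5,6) power2_eq_square mult.assoc times_divide_eq_left)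
  then show ?thesis
    using integral_sq_step[of x z] unfolding w_def[symmetric] h_def[folded w_def, symmetric] drift_def
    by (simp add: distrib_right)
qed

section \<open>The deterministic reference sequence\<close>

primrec ref :: "'a \<Rightarrow> nat \<Rightarrow> 'a" where
  "ref z 0 = z"
| "ref z (Suc j) = ref z j - \<alpha> *\<^sub>R R (ref z j)"

text \<open>
  Cocoercivity between two consecutive points of the orbit, whose difference is \<open>\<alpha> w\<close>, reads
  \<open>|w' - w|\<^sup>2 \<le> 2 \<alpha> \<theta> \<langle>w - w', w\<rangle>\<close>; expanding \<open>|w'|\<^sup>2\<close> around \<open>w\<close> turns this into a decrease of \<open>|w|\<^sup>2\<close>.
\<close>

lemma sq_R_ref_decrease:
  "ip (R (ref z (Suc j))) (R (ref z (Suc j)))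
    + (1 / (\<alpha> * \<theta>) - 1) * ip (R (ref z (Suc j)) - R (ref z j)) (R (ref z (Suc j)) - R (ref z j))
    \<le> ip (R (ref z j)) (R (ref z j))"
proof -
  define w w' where "w = R (ref z j)" and "w' = R (ref z (Suc j))"
  have "ip (w - w') (w - w') \<le> 2 * \<theta> * ip (w - w') (\<alpha> *\<^sub>R w)"
    using R_cocoercive[of "ref z j" "ref z (Suc j)"] by (simp add: w_def w'_def)
  then have "ip (w' - w) (w' - w) \<le> 2 * (\<alpha> * \<theta>) * ip (w - w') w"
    by (simp add: ip_sq_diff bilinear_ip ip_commute algebra_simps)
  then have "1 / (\<alpha> * \<theta>) * ip (w' - w) (w' - w) \<le> 2 * ip (w - w') w"
    using alpha theta by (simp add: field_simps)
  moreover have "ip w' w' = ip w w - 2 * ip (w - w') w + ip (w' - w) (w' - w)"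
    by (simp add: ip_sq_diff) (simp add: bilinear_ip ip_commute)
  ultimately show ?thesis
    unfolding w_def[symmetric] w'_def[symmetric] by (simp only: left_diff_distrib)
qed

lemma sq_R_ref_le: "ip (R (ref z j)) (R (ref z j)) \<le> ip (R z) (R z)"
proof (induction j)
  case (Suc j)
  have "0 \<le> (1 / (\<alpha> * \<theta>) - 1) *
      ip (R (ref z (Suc j)) - R (ref z j)) (R (ref z (Suc j)) - R (ref z j))"
    using alpha theta alpha_theta_less_1 by simp
  then show ?case using sq_R_ref_decrease[of z j] Suc by linarith
qed simp

lemma sum_sq_R_ref_diff:
  assumes L: "\<And>x. L \<le> ip (R x) (R x)"
  shows "(\<Sum>j<k. ip (R (ref z (Suc j)) - R (ref z j)) (R (ref z (Suc j)) - R (ref z j)))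
    \<le> (ip (R z) (R z) - L) / (1 / (\<alpha> * \<theta>) - 1)"
proof -
  have pos: "0 < 1 / (\<alpha> * \<theta>) - 1" using alpha theta alpha_theta_less_1 by simp
  have "(1 / (\<alpha> * \<theta>) - 1) *
      (\<Sum>j<k. ip (R (ref z (Suc j)) - R (ref z j)) (R (ref z (Suc j)) - R (ref z j)))
      \<le> ip (R z) (R z) - ip (R (ref z k)) (R (ref z k))"
  proof (induction k)
    case (Suc k)
    then show ?case using sq_R_ref_decrease[of z k] by (simp add: distrib_left del: ref.simps)
  qed simp
  also have "\<dots> \<le> ip (R z) (R z) - L" using L[of "ref z k"] by simp
  finally show ?thesis using pos by (simp add: field_simps)
qed

lemma norm_wrt_ref_le: "norm_wrt M (ref z k) \<le> norm_wrt M z + real k * (\<alpha> * norm_wrt M (R z))"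
proof (induction k)
  case (Suc k)
  have "norm_wrt M (ref z (Suc k)) \<le> norm_wrt M (ref z k) + norm_wrt M (- \<alpha> *\<^sub>R R (ref z k))"
    using norm_wrt_triangle[of "ref z k" "- \<alpha> *\<^sub>R R (ref z k)"] by simp
  also have "norm_wrt M (- \<alpha> *\<^sub>R R (ref z k)) = \<alpha> * norm_wrt M (R (ref z k))"
    using alpha by (simp only: norm_wrt_scaleR)
  also have "\<dots> \<le> \<alpha> * norm_wrt M (R z)"
    using alpha sq_R_ref_le[of z k] by (simp add: norm_wrt_eq)
  finally show ?case using Suc by (simp add: distrib_right)
qed simp

end

section \<open>Expectations along the random iteration\<close>

text \<open>
  The random iteration itself, driven by independent selections with distribution \<open>\<mu>\<close>.
\<close>

locale random_block_iteration = random_block_step M H T \<theta> \<alpha> \<beta> \<mu> + prob_space P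
  for M :: "'a::{real_inner,complete_space} \<Rightarrow> 'a" and H :: "'m::finite \<Rightarrow> 'a set"
    and T :: "'a \<Rightarrow> 'a" and \<theta> \<alpha> \<beta> :: real and \<mu> :: "(real^'m) measure"
    and P :: "'w measure" +
  fixes sel :: "nat \<Rightarrow> 'w \<Rightarrow> real^'m" and x :: "nat \<Rightarrow> 'w \<Rightarrow> 'a" and x0 :: 'a
  assumes indep: "indep_vars (\<lambda>_. borel) sel UNIV"
    and distr_sel: "\<And>k. distr P borel (sel k) = \<mu>"
    and sel_box: "\<And>k \<omega>. \<omega> \<in> space P \<Longrightarrow> sel k \<omega> \<in> cbox 0 1"
    and x_0: "\<And>\<omega>. \<omega> \<in> space P \<Longrightarrow> x 0 \<omega> = x0"
    and x_Suc: "\<And>k \<omega>. \<omega> \<in> space P \<Longrightarrow> x (Suc k) \<omega> = T_sel H \<theta> T (sel k \<omega>) (x k \<omega>)"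
begin

primrec traj :: "(nat \<Rightarrow> real^'m) \<Rightarrow> nat \<Rightarrow> 'a" where
  "traj a 0 = x0"
| "traj a (Suc k) = step (a k) (traj a k)"

lemma x_eq_traj: "\<omega> \<in> space P \<Longrightarrow> x k \<omega> = traj (\<lambda>n. sel n \<omega>) k"
  by (induction k) (simp_all add: x_0 x_Suc)

lemma traj_cong: "(\<And>n. n < k \<Longrightarrow> a n = b n) \<Longrightarrow> traj a k = traj b k"
  by (induction k) simp_all

lemma continuous_on_traj: "continuous_on UNIV (\<lambda>a. traj a k)"
  by (induction k) (auto intro!: continuous_on_step continuous_on_product_coordinates)

lemma measurable_sel [measurable]: "sel k \<in> borel_measurable P"
  using indep by (simp add: indep_vars_def)

lemma measurable_sel_seq: "(\<lambda>\<omega> n. sel n \<omega>) \<in> borel_measurable P"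
  by (intro measurable_coordinatewise_then_product) simp

text \<open>
  All selections lie in the cube, and the product of countably many cubes is compact, so a
  continuous function of the selections is bounded.
\<close>

lemma integrable_continuous_sel:
  fixes f :: "(nat \<Rightarrow> real^'m) \<Rightarrow> real"
  assumes f: "continuous_on UNIV f"
  shows "integrable P (\<lambda>\<omega>. f (\<lambda>n. sel n \<omega>))"
proof -
  define K where "K = (PiE UNIV (\<lambda>_. cbox 0 1) :: (nat \<Rightarrow> real^'m) set)"
  have "compactin euclidean K"
    unfolding K_def euclidean_product_topology[symmetric] compactin_PiE by simp
  then have "compact (f ` K)"
    by (intro compact_continuous_image continuous_on_subset[OF f]) auto
  then obtain B where B: "\<And>a. a \<in> K \<Longrightarrow> norm (f a) \<le> B"
    by (meson bounded_iff compact_imp_bounded imageI)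
  show ?thesis
  proof (rule integrable_const_bound)
    show "AE \<omega> in P. norm (f (\<lambda>n. sel n \<omega>)) \<le> B"
      by (intro AE_I2 B) (auto simp: K_def sel_box)
    show "(\<lambda>\<omega>. f (\<lambda>n. sel n \<omega>)) \<in> borel_measurable P"
      using borel_measurable_continuous_onI[OF f] measurable_sel_seq by (rule measurable_compose[rotated])
  qed
qed

lemma integrable_continuous_x:
  assumes \<phi>: "continuous_on UNIV \<phi>"
  shows "integrable P (\<lambda>\<omega>. \<phi> (x k \<omega>) :: real)"
proof -
  have "integrable P (\<lambda>\<omega>. \<phi> (traj (\<lambda>n. sel n \<omega>) k))"
    by (intro integrable_continuous_sel[where f = "\<lambda>a. \<phi> (traj a k)"]
        continuous_on_compose2[OF \<phi> continuous_on_traj]) auto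
  then show ?thesis
    by (subst Bochner_Integration.integrable_cong[OF refl]) (auto simp: x_eq_traj)
qed

text \<open>
  The selections before time \<open>k\<close> and the one at time \<open>k\<close>, both encoded as sequences because
  \<open>indep_var\<close> relates random variables with values in one type.
\<close>

definition past :: "nat \<Rightarrow> 'w \<Rightarrow> nat \<Rightarrow> real^'m" where
  "past k \<omega> n = (if n < k then sel n \<omega> else 0)"

lemma x_eq_traj_past: "\<omega> \<in> space P \<Longrightarrow> x k \<omega> = traj (past k \<omega>) k"
  unfolding x_eq_traj by (rule traj_cong) (simp add: past_def)

definition present :: "nat \<Rightarrow> 'w \<Rightarrow> nat \<Rightarrow> real^'m" where
  "present k \<omega> n = sel k \<omega>"

lemma indep_past_present: "indep_var borel (past k) borel (present k)"
proof -
  define g where "g = (\<lambda>(r :: nat \<Rightarrow> real^'m) n. if n < k then r n else 0)"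
  define g' where "g' = (\<lambda>(r :: nat \<Rightarrow> real^'m) (n :: nat). r k)"
  have g: "g \<in> borel_measurable (PiM {..<k} (\<lambda>_. borel))"
  proof (rule measurable_coordinatewise_then_product)
    show "(\<lambda>r. g r n) \<in> borel_measurable (PiM {..<k} (\<lambda>_. borel))" for n
      unfolding g_def by (cases "n < k") simp_all
  qed
  have g': "g' \<in> borel_measurable (PiM {k} (\<lambda>_. borel))"
    unfolding g'_def by (rule measurable_coordinatewise_then_product) simp
  have "indep_var borel (g \<circ> (\<lambda>\<omega>. restrict (\<lambda>i. sel i \<omega>) {..<k}))
      borel (g' \<circ> (\<lambda>\<omega>. restrict (\<lambda>i. sel i \<omega>) {k}))"
    by (rule indep_var_compose[OF indep_var_restrict[OF indep] g g']) auto
  also have "g \<circ> (\<lambda>\<omega>. restrict (\<lambda>i. sel i \<omega>) {..<k}) = past k"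
    by (auto simp: g_def past_def fun_eq_iff)
  also have "g' \<circ> (\<lambda>\<omega>. restrict (\<lambda>i. sel i \<omega>) {k}) = present k"
    by (auto simp: g'_def present_def fun_eq_iff)
  finally show ?thesis .
qed

text \<open>
  The Markov property: \<open>x\<^sup>k\<close> is a function of the past, which is independent of the selection at time \<open>k\<close>,
  so Fubini's theorem integrates out that selection first.
\<close>

lemma expectation_step:
  fixes \<phi> :: "'a \<Rightarrow> real"
  assumes \<phi>: "continuous_on UNIV \<phi>"
  shows "integrable P (\<lambda>\<omega>. \<integral>s. \<phi> (step s (x k \<omega>)) \<partial>\<mu>)"
    and "expectation (\<lambda>\<omega>. \<phi> (x (Suc k) \<omega>)) = expectation (\<lambda>\<omega>. \<integral>s. \<phi> (step s (x k \<omega>)) \<partial>\<mu>)"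
proof -
  define h where "h = (\<lambda>z. \<phi> (step (snd z (0::nat)) (traj (fst z) k)))"
  have "continuous_on UNIV h"
    unfolding h_def
    by (intro continuous_on_compose2[OF \<phi>] continuous_on_step
        continuous_on_compose2[OF continuous_on_traj] continuous_intros
        continuous_on_product_then_coordinatewise) auto
  then have h: "h \<in> borel_measurable (borel \<Otimes>\<^sub>M borel)"
    unfolding borel_prod by (rule borel_measurable_continuous_onI)
  have rv: "past k \<in> borel_measurable P" "present k \<in> borel_measurable P"
    using indep_past_present[of k] indep_var_rv1 indep_var_rv2 by blast+
  have pair: "(\<lambda>\<omega>. (past k \<omega>, present k \<omega>)) \<in> measurable P (borel \<Otimes>\<^sub>M borel)"
    using rv by simp
  define A B where "A = distr P borel (past k)" and "B = distr P borel (present k)"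
  have J: "distr P (borel \<Otimes>\<^sub>M borel) (\<lambda>\<omega>. (past k \<omega>, present k \<omega>)) = A \<Otimes>\<^sub>M B"
    using indep_past_present[of k] by (simp add: indep_var_distribution_eq A_def B_def)
  interpret A: prob_space A unfolding A_def by (rule prob_space_distr[OF rv(1)])
  interpret B: prob_space B unfolding B_def by (rule prob_space_distr[OF rv(2)])
  interpret pair_sigma_finite A B ..
  have h_eq: "h (past k \<omega>, b) = \<phi> (step (b 0) (x k \<omega>))" if "\<omega> \<in> space P" for \<omega> b
    using that by (simp add: h_def x_eq_traj_past)
  have inner_eq: "(\<integral>b. h (past k \<omega>, b) \<partial>B) = (\<integral>s. \<phi> (step s (x k \<omega>)) \<partial>\<mu>)"
    if \<omega>: "\<omega> \<in> space P" for \<omega>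
  proof -
    define f where "f = (\<lambda>s. \<phi> (step s (x k \<omega>)))"
    have "continuous_on UNIV f"
      unfolding f_def
      by (intro continuous_on_compose2[OF \<phi>] continuous_on_step continuous_intros) auto
    then have f [measurable]: "f \<in> borel_measurable borel" by (rule borel_measurable_continuous_onI)
    have f0: "(\<lambda>b. f (b (0::nat))) \<in> borel_measurable borel"
      by (intro borel_measurable_continuous_onI continuous_on_compose2[OF \<open>continuous_on UNIV f\<close>]
          continuous_on_product_coordinates) auto
    have "(\<integral>b. h (past k \<omega>, b) \<partial>B) = (\<integral>b. f (b 0) \<partial>B)"
      by (simp add: h_eq[OF \<omega>] f_def)
    also have "\<dots> = (\<integral>\<omega>'. f (sel k \<omega>') \<partial>P)"
      unfolding B_def integral_distr[OF rv(2) f0] by (simp add: present_def)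
    also have "\<dots> = (\<integral>s. f s \<partial>\<mu>)"
      unfolding distr_sel[of k, symmetric] by (rule integral_distr[symmetric]) measurable
    finally show ?thesis by (simp add: f_def)
  qed
  have "integrable P (\<lambda>\<omega>. h (past k \<omega>, present k \<omega>))"
    using integrable_continuous_x[OF \<phi>, of "Suc k"]
    by (subst Bochner_Integration.integrable_cong[OF refl]) (auto simp: h_eq x_Suc present_def)
  then have hJ: "integrable (A \<Otimes>\<^sub>M B) h"
    unfolding J[symmetric] integrable_distr_eq[OF pair h] .
  have inner: "integrable A (\<lambda>a. \<integral>b. h (a, b) \<partial>B)"
    by (rule integrable_fst'[OF hJ])
  have "integrable P (\<lambda>\<omega>. \<integral>b. h (past k \<omega>, b) \<partial>B)"
    using integrable_distr[OF rv(1) inner[unfolded A_def]] .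
  moreover have "integrable P (\<lambda>\<omega>. \<integral>b. h (past k \<omega>, b) \<partial>B)
      \<longleftrightarrow> integrable P (\<lambda>\<omega>. \<integral>s. \<phi> (step s (x k \<omega>)) \<partial>\<mu>)"
    by (rule Bochner_Integration.integrable_cong[OF refl inner_eq])
  ultimately show "integrable P (\<lambda>\<omega>. \<integral>s. \<phi> (step s (x k \<omega>)) \<partial>\<mu>)" by simp
  have "expectation (\<lambda>\<omega>. \<phi> (x (Suc k) \<omega>)) = expectation (\<lambda>\<omega>. h (past k \<omega>, present k \<omega>))"
    by (intro Bochner_Integration.integral_cong refl) (simp add: h_eq x_Suc present_def)
  also have "\<dots> = integral\<^sup>L (A \<Otimes>\<^sub>M B) h"
    unfolding J[symmetric] by (rule integral_distr[OF pair h, symmetric])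
  also have "\<dots> = (\<integral>a. \<integral>b. h (a, b) \<partial>B \<partial>A)"
    by (rule integral_fst'[OF hJ, symmetric])
  also have "\<dots> = expectation (\<lambda>\<omega>. \<integral>b. h (past k \<omega>, b) \<partial>B)"
    using inner unfolding A_def by (intro integral_distr[OF rv(1)]) auto
  also have "\<dots> = expectation (\<lambda>\<omega>. \<integral>s. \<phi> (step s (x k \<omega>)) \<partial>\<mu>)"
    by (intro Bochner_Integration.integral_cong refl inner_eq)
  finally show "expectation (\<lambda>\<omega>. \<phi> (x (Suc k) \<omega>))
    = expectation (\<lambda>\<omega>. \<integral>s. \<phi> (step s (x k \<omega>)) \<partial>\<mu>)" .
qed

lemma expectation_step_le:
  fixes \<phi> \<psi> :: "'a \<Rightarrow> real"
  assumes \<phi>: "continuous_on UNIV \<phi>" and \<psi>: "continuous_on UNIV \<psi>"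
    and le: "\<And>y. (\<integral>s. \<phi> (step s y) \<partial>\<mu>) \<le> \<psi> y"
  shows "expectation (\<lambda>\<omega>. \<phi> (x (Suc k) \<omega>)) \<le> expectation (\<lambda>\<omega>. \<psi> (x k \<omega>))"
  unfolding expectation_step(2)[OF \<phi>]
  by (intro integral_mono expectation_step(1) integrable_continuous_x \<phi> \<psi> le)

end

section \<open>Mean square deviation from the reference sequence\<close>

context random_block_iteration
begin

definition msd :: "'a \<Rightarrow> nat \<Rightarrow> real" where
  "msd z k = expectation (\<lambda>\<omega>. ip (x k \<omega> - ref z k) (x k \<omega> - ref z k))"

definition exp_lyap :: "'a \<Rightarrow> nat \<Rightarrow> real" where
  "exp_lyap z k = expectation (\<lambda>\<omega>. lyap (ref z k) (R (ref z k)) (x k \<omega>))"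

lemma continuous_on_sq_dist: "continuous_on UNIV (\<lambda>y. ip (y - z) (y - z))"
  by (intro continuous_intros)

lemma continuous_on_lyap: "continuous_on UNIV (lyap z w)"
  unfolding lyap_def[abs_def] by (intro continuous_intros)

lemma msd_step: "msd z (Suc k) \<le> msd z k + drift * ip (R z) (R z)"
proof -
  have "msd z (Suc k)
      \<le> expectation (\<lambda>\<omega>. ip (x k \<omega> - ref z k) (x k \<omega> - ref z k) + drift * ip (R (ref z k)) (R (ref z k)))"
    unfolding msd_def ref.simps
    by (rule expectation_step_le[where \<phi> = "\<lambda>y. ip (y - _) (y - _)" and
          \<psi> = "\<lambda>y. ip (y - ref z k) (y - ref z k) + drift * ip (R (ref z k)) (R (ref z k))"])
      (intro continuous_intros integral_sq_step_crude)+
  also have "\<dots> = msd z k + drift * ip (R (ref z k)) (R (ref z k))"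
    unfolding msd_def
    by (subst Bochner_Integration.integral_add)
      (auto simp: prob_space intro!: integrable_continuous_x continuous_on_sq_dist)
  also have "\<dots> \<le> msd z k + drift * ip (R z) (R z)"
    using mult_left_mono[OF sq_R_ref_le drift_nonneg] by simp
  finally show ?thesis .
qed

lemma msd_crude: "msd z k \<le> msd z 0 + real k * (drift * ip (R z) (R z))"
proof (induction k)
  case (Suc k)
  then show ?case using msd_step[of z k] by (simp add: distrib_right)
qed simp

text \<open>
  By \<open>integral_lyap_step\<close> for the old displacement \<open>w\<close>; replacing \<open>w\<close> by the new one \<open>w'\<close> costs
  \<open>2 \<kappa> \<langle>d', w' - w\<rangle>\<close>, which Young's inequality splits.
\<close>

lemma exp_lyap_step:
  assumes "0 < t"
  shows "exp_lyap z (Suc k) \<le> exp_lyap z k + (\<beta> - \<alpha>\<^sup>2) * ip (R z) (R z) + t * msd z (Suc k)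
    + \<kappa>\<^sup>2 / t * ip (R (ref z (Suc k)) - R (ref z k)) (R (ref z (Suc k)) - R (ref z k))"
proof -
  define z' w w' where "z' = ref z (Suc k)" and "w = R (ref z k)" and "w' = R (ref z (Suc k))"
  have pointwise: "lyap z' w' y \<le> lyap z' w y + (t * ip (y - z') (y - z')
      + \<kappa>\<^sup>2 / t * ip (w' - w) (w' - w))" for y
  proof -
    have "lyap z' w' y = lyap z' w y + 2 * ip (y - z') (\<kappa> *\<^sub>R (w' - w))"
      by (simp add: lyap_def bilinear_ip algebra_simps)
    also have "2 * ip (y - z') (\<kappa> *\<^sub>R (w' - w)) \<le> t * ip (y - z') (y - z')
        + ip (\<kappa> *\<^sub>R (w' - w)) (\<kappa> *\<^sub>R (w' - w)) / t"
      by (rule ip_young[OF assms])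
    also have "ip (\<kappa> *\<^sub>R (w' - w)) (\<kappa> *\<^sub>R (w' - w)) / t = \<kappa>\<^sup>2 / t * ip (w' - w) (w' - w)"
      by (simp add: bilinear_ip(5,6) power2_eq_square)
    finally show ?thesis by simp
  qed
  have int: "integrable P (\<lambda>\<omega>. lyap z' w (x (Suc k) \<omega>))" "integrable P (\<lambda>\<omega>. lyap z' w' (x (Suc k) \<omega>))"
    "integrable P (\<lambda>\<omega>. ip (x (Suc k) \<omega> - z') (x (Suc k) \<omega> - z'))"
    "integrable P (\<lambda>\<omega>. lyap (ref z k) w (x k \<omega>))"
    by (intro integrable_continuous_x continuous_on_lyap continuous_on_sq_dist)+
  have "exp_lyap z (Suc k) \<le> expectation (\<lambda>\<omega>. lyap z' w (x (Suc k) \<omega>)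
      + (t * ip (x (Suc k) \<omega> - z') (x (Suc k) \<omega> - z') + \<kappa>\<^sup>2 / t * ip (w' - w) (w' - w)))"
    unfolding exp_lyap_def w'_def[folded z'_def, symmetric] z'_def[symmetric]
    using int by (intro integral_mono pointwise) auto
  also have "\<dots> = expectation (\<lambda>\<omega>. lyap z' w (x (Suc k) \<omega>)) + t * msd z (Suc k)
      + \<kappa>\<^sup>2 / t * ip (w' - w) (w' - w)"
    using int by (simp add: prob_space msd_def z'_def)
  also have "expectation (\<lambda>\<omega>. lyap z' w (x (Suc k) \<omega>))
      \<le> expectation (\<lambda>\<omega>. lyap (ref z k) w (x k \<omega>) + (\<beta> - \<alpha>\<^sup>2) * ip w w)"
    unfolding z'_def w_def ref.simps
    by (rule expectation_step_le[where \<psi> = "\<lambda>y. lyap (ref z k) (R (ref z k)) y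
          + (\<beta> - \<alpha>\<^sup>2) * ip (R (ref z k)) (R (ref z k))"])
      (intro continuous_on_lyap continuous_intros integral_lyap_step)+
  also have "\<dots> = exp_lyap z k + (\<beta> - \<alpha>\<^sup>2) * ip w w"
    using int by (simp add: prob_space exp_lyap_def w_def)
  also have "(\<beta> - \<alpha>\<^sup>2) * ip w w \<le> (\<beta> - \<alpha>\<^sup>2) * ip (R z) (R z)"
    unfolding w_def using alpha_sq_le_beta by (intro mult_left_mono sq_R_ref_le) simp
  finally show ?thesis by (simp add: w_def w'_def)
qed

lemma msd_le_exp_lyap:
  assumes "0 < \<sigma>"
  shows "msd z k \<le> exp_lyap z k + \<sigma> * msd z k + \<kappa>\<^sup>2 / \<sigma> * ip (R z) (R z)"
proof -
  define w where "w = R (ref z k)"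
  have pointwise: "ip (y - ref z k) (y - ref z k) \<le> lyap (ref z k) w y
      + (\<sigma> * ip (y - ref z k) (y - ref z k) + \<kappa>\<^sup>2 / \<sigma> * ip (R z) (R z))" for y
  proof -
    have "2 * ip (y - ref z k) ((- \<kappa>) *\<^sub>R w)
        \<le> \<sigma> * ip (y - ref z k) (y - ref z k) + ip ((- \<kappa>) *\<^sub>R w) ((- \<kappa>) *\<^sub>R w) / \<sigma>"
      by (rule ip_young[OF assms])
    also have "ip ((- \<kappa>) *\<^sub>R w) ((- \<kappa>) *\<^sub>R w) / \<sigma> = \<kappa>\<^sup>2 / \<sigma> * ip w w"
      by (simp only: bilinear_ip(5,6)) (simp add: power2_eq_square)
    also have "\<dots> \<le> \<kappa>\<^sup>2 / \<sigma> * ip (R z) (R z)"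
      unfolding w_def using assms by (intro mult_left_mono sq_R_ref_le) simp
    finally have "- (2 * \<kappa> * ip (y - ref z k) w)
        \<le> \<sigma> * ip (y - ref z k) (y - ref z k) + \<kappa>\<^sup>2 / \<sigma> * ip (R z) (R z)"
      by (simp only: bilinear_ip(6)) simp
    then show ?thesis unfolding lyap_def by linarith
  qed
  have int: "integrable P (\<lambda>\<omega>. ip (x k \<omega> - ref z k) (x k \<omega> - ref z k))"
    "integrable P (\<lambda>\<omega>. lyap (ref z k) w (x k \<omega>))"
    by (intro integrable_continuous_x continuous_on_lyap continuous_on_sq_dist)+
  have "msd z k \<le> expectation (\<lambda>\<omega>. lyap (ref z k) w (x k \<omega>)
      + (\<sigma> * ip (x k \<omega> - ref z k) (x k \<omega> - ref z k) + \<kappa>\<^sup>2 / \<sigma> * ip (R z) (R z)))"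
    unfolding msd_def using int by (intro integral_mono pointwise) auto
  then show ?thesis using int by (simp add: prob_space msd_def exp_lyap_def w_def)
qed

text \<open>
  Bound for the linear growth rate of the mean square deviation: the variance per step, the
  price \<open>\<sigma>\<close> of each of two applications of Young's inequality, and the reciprocal part of one of them,
  in which the variation of the displacements is bounded as in \<open>sum_sq_R_ref_diff\<close>. Here \<open>\<rho>\<close> is the norm of
  the first displacement and \<open>L\<close> a lower bound of all displacements.
\<close>

definition growth :: "real \<Rightarrow> real \<Rightarrow> real \<Rightarrow> real" where
  "growth L \<sigma> \<rho> = (\<beta> - \<alpha>\<^sup>2) * \<rho>\<^sup>2 + 2 * \<sigma> * (drift * \<rho>\<^sup>2)
    + \<kappa>\<^sup>2 / \<sigma> * ((\<rho>\<^sup>2 - L\<^sup>2) / (1 / (\<alpha> * \<theta>) - 1))"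

text \<open>
  The \<open>k\<close> steps up to time \<open>k\<close> are summed with the weight \<open>\<sigma>/k\<close> in Young's inequality: the deviations, each at most
  of order \<open>k\<close>, then contribute \<open>\<sigma>\<close> times that order in total, and the summable squared changes of the displacements are
  multiplied by \<open>k/\<sigma>\<close>.
\<close>

lemma msd_linear_growth:
  assumes \<sigma>: "0 < \<sigma>" and L: "0 \<le> L" "\<And>y. L \<le> norm_wrt M (R y)"
  obtains C where "\<And>k. 0 < k \<Longrightarrow> msd z k \<le> C + real k * growth L \<sigma> (norm_wrt M (R z))"
proof -
  define r2 A where "r2 = ip (R z) (R z)" and "A = (r2 - L\<^sup>2) / (1 / (\<alpha> * \<theta>) - 1)"
  define a where "a j = ip (R (ref z (Suc j)) - R (ref z j)) (R (ref z (Suc j)) - R (ref z j))" for j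
  have "L\<^sup>2 \<le> ip (R y) (R y)" for y
    using power_mono[OF L(2)[of y] L(1), of 2] by (simp add: norm_wrt_sq)
  then have a_sum: "(\<Sum>j<k. a j) \<le> A" for k
    unfolding a_def A_def r2_def by (rule sum_sq_R_ref_diff)
  define C where "C = exp_lyap z 0 + 2 * \<sigma> * msd z 0 + \<kappa>\<^sup>2 / \<sigma> * r2"
  show thesis
  proof (rule that[of C])
    fix k :: nat
    assume k: "0 < k"
    \<comment> \<open>The weight depends on the final time k, not on the summation index.\<close>
    define t where "t = \<sigma> / real k"
    have t: "0 < t" "real k * t = \<sigma>" "\<kappa>\<^sup>2 / t = real k * (\<kappa>\<^sup>2 / \<sigma>)"
      using \<sigma> k by (auto simp: t_def)
    define m where "m = msd z 0 + real k * (drift * r2)"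
    have m: "msd z j \<le> m" if "j \<le> k" for j
    proof -
      have "real j * (drift * r2) \<le> real k * (drift * r2)"
        using that drift_nonneg by (intro mult_right_mono) (auto simp: r2_def)
      then show ?thesis using msd_crude[of z j] by (simp add: m_def r2_def)
    qed
    have "exp_lyap z n \<le> exp_lyap z 0 + real n * ((\<beta> - \<alpha>\<^sup>2) * r2) + real n * (t * m)
        + \<kappa>\<^sup>2 / t * (\<Sum>j<n. a j)" if "n \<le> k" for n
      using that
    proof (induction n)
      case (Suc n)
      have "t * msd z (Suc n) \<le> t * m" using t m Suc.prems by (intro mult_left_mono) auto
      moreover have "exp_lyap z (Suc n) \<le> exp_lyap z n + (\<beta> - \<alpha>\<^sup>2) * r2 + t * msd z (Suc n)
          + \<kappa>\<^sup>2 / t * a n"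
        using exp_lyap_step[OF t(1)] by (simp add: r2_def a_def)
      moreover have "exp_lyap z n \<le> exp_lyap z 0 + real n * ((\<beta> - \<alpha>\<^sup>2) * r2) + real n * (t * m)
          + \<kappa>\<^sup>2 / t * (\<Sum>j<n. a j)"
        using Suc by simp
      moreover have "real (Suc n) * ((\<beta> - \<alpha>\<^sup>2) * r2) = real n * ((\<beta> - \<alpha>\<^sup>2) * r2) + (\<beta> - \<alpha>\<^sup>2) * r2"
        "real (Suc n) * (t * m) = real n * (t * m) + t * m"
        by (simp_all add: distrib_right)
      moreover have "\<kappa>\<^sup>2 / t * (\<Sum>j<Suc n. a j) = \<kappa>\<^sup>2 / t * (\<Sum>j<n. a j) + \<kappa>\<^sup>2 / t * a n"
        by (simp only: sum.lessThan_Suc distrib_left)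
      ultimately show ?case by linarith
    qed simp
    from this[of k] have "exp_lyap z k \<le> exp_lyap z 0 + real k * ((\<beta> - \<alpha>\<^sup>2) * r2) + \<sigma> * m
        + \<kappa>\<^sup>2 / t * (\<Sum>j<k. a j)"
      using t(2) by (simp add: mult.assoc[symmetric])
    moreover have "\<kappa>\<^sup>2 / t * (\<Sum>j<k. a j) \<le> \<kappa>\<^sup>2 / t * A"
      using t(1) by (intro mult_left_mono a_sum) simp
    moreover have "\<sigma> * msd z k \<le> \<sigma> * m" using \<sigma> m by (intro mult_left_mono) auto
    ultimately have "msd z k \<le> exp_lyap z 0 + real k * ((\<beta> - \<alpha>\<^sup>2) * r2) + 2 * \<sigma> * m
        + real k * (\<kappa>\<^sup>2 / \<sigma>) * A + \<kappa>\<^sup>2 / \<sigma> * r2"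
      using msd_le_exp_lyap[OF \<sigma>, of z k] unfolding t(3) r2_def by linarith
    also have "\<dots> = C + real k * growth L \<sigma> (norm_wrt M (R z))"
      unfolding C_def growth_def m_def A_def norm_wrt_sq r2_def[symmetric]
      by (simp add: algebra_simps)
    finally show "msd z k \<le> C + real k * growth L \<sigma> (norm_wrt M (R z))" .
  qed
qed

text \<open>
  Chebyshev's inequality: if \<open>|x\<^sup>k| \<ge> k \<epsilon>\<close>, then the deviation from the reference point is at least
  \<open>k \<epsilon> - |z\<^sub>k|\<close>.
\<close>

lemma prob_le_msd:
  assumes k: "0 < k" and \<gamma>: "0 < real k * (\<epsilon> - \<alpha> * norm_wrt M (R z)) - norm_wrt M z"
  shows "measure P {\<omega> \<in> space P. norm_wrt M (x k \<omega> /\<^sub>R real k) \<ge> \<epsilon>}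
    \<le> msd z k / (real k * (\<epsilon> - \<alpha> * norm_wrt M (R z)) - norm_wrt M z)\<^sup>2"
proof -
  define \<gamma> where "\<gamma> = real k * (\<epsilon> - \<alpha> * norm_wrt M (R z)) - norm_wrt M z"
  define Y where "Y \<omega> = ip (x k \<omega> - ref z k) (x k \<omega> - ref z k)" for \<omega>
  have Y: "integrable P Y"
    unfolding Y_def by (intro integrable_continuous_x continuous_on_sq_dist)
  have far: "\<gamma>\<^sup>2 \<le> Y \<omega>" if "\<epsilon> \<le> norm_wrt M (x k \<omega> /\<^sub>R real k)" for \<omega>
  proof -
    have "real k * \<epsilon> \<le> norm_wrt M (x k \<omega>)"
      using that k by (simp add: norm_wrt_scaleR field_simps)
    also have "\<dots> \<le> norm_wrt M (x k \<omega> - ref z k) + norm_wrt M (ref z k)"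
      using norm_wrt_triangle[of "x k \<omega> - ref z k" "ref z k"] by simp
    finally have "\<gamma> \<le> norm_wrt M (x k \<omega> - ref z k)"
      using norm_wrt_ref_le[of z k] by (simp add: \<gamma>_def right_diff_distrib)
    then have "\<gamma>\<^sup>2 \<le> (norm_wrt M (x k \<omega> - ref z k))\<^sup>2"
      using \<gamma> by (intro power_mono) (auto simp: \<gamma>_def)
    then show ?thesis by (simp add: Y_def norm_wrt_sq)
  qed
  have "measure P {\<omega> \<in> space P. norm_wrt M (x k \<omega> /\<^sub>R real k) \<ge> \<epsilon>}
      \<le> measure P {\<omega> \<in> space P. Y \<omega> \<ge> \<gamma>\<^sup>2}"
    using Y by (intro finite_measure_mono) (auto intro: far)
  also have "\<dots> \<le> (\<integral>\<omega>. Y \<omega> \<partial>P) / \<gamma>\<^sup>2"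
    using \<gamma> by (intro integral_Markov_inequality_measure[OF Y, of "{}"])
      (auto simp: Y_def \<gamma>_def)
  finally show ?thesis by (simp add: Y_def msd_def \<gamma>_def)
qed

section \<open>The limit superior\<close>

lemma limsup_prob_le_growth:
  assumes \<sigma>: "0 < \<sigma>" and L: "0 \<le> L" "\<And>y. L \<le> norm_wrt M (R y)"
    and \<epsilon>: "\<alpha> * norm_wrt M (R z) < \<epsilon>"
  shows "limsup (\<lambda>k. ereal (real k *
      measure P {\<omega> \<in> space P. norm_wrt M (x k \<omega> /\<^sub>R real k) \<ge> \<epsilon>}))
    \<le> ereal (growth L \<sigma> (norm_wrt M (R z)) / (\<epsilon> - \<alpha> * norm_wrt M (R z))\<^sup>2)"
proof -
  define g c b where "g = growth L \<sigma> (norm_wrt M (R z))"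
    and "c = \<epsilon> - \<alpha> * norm_wrt M (R z)" and "b = norm_wrt M z"
  have c: "0 < c" using \<epsilon> by (simp add: c_def)
  obtain C where C: "\<And>k. 0 < k \<Longrightarrow> msd z k \<le> C + real k * g"
    using msd_linear_growth[OF \<sigma> L, of z] unfolding g_def by blast
  define f where "f k = (C / real k + g) / (c - b / real k)\<^sup>2" for k
  have "f \<longlonglongrightarrow> (0 + g) / (c - 0)\<^sup>2"
    unfolding f_def using c by (intro tendsto_intros lim_const_over_n) auto
  then have lim: "(\<lambda>k. ereal (f k)) \<longlonglongrightarrow> ereal (g / c\<^sup>2)" by simp
  have "(\<lambda>k. c - b / real k) \<longlonglongrightarrow> c - 0" by (intro tendsto_intros lim_const_over_n)
  then have "\<forall>\<^sub>F k in sequentially. 0 < c - b / real k"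
    using c by (intro order_tendstoD(1)) auto
  then have "\<forall>\<^sub>F k in sequentially. ereal (real k *
      measure P {\<omega> \<in> space P. norm_wrt M (x k \<omega> /\<^sub>R real k) \<ge> \<epsilon>}) \<le> ereal (f k)"
    using eventually_gt_at_top[of 0]
  proof eventually_elim
    case (elim k)
    have eq: "real k * c - b = real k * (c - b / real k)" using elim by (simp add: field_simps)
    then have pos: "0 < real k * c - b" using elim by simp
    have "measure P {\<omega> \<in> space P. norm_wrt M (x k \<omega> /\<^sub>R real k) \<ge> \<epsilon>}
        \<le> msd z k / (real k * c - b)\<^sup>2"
      using prob_le_msd[of k \<epsilon> z] elim pos by (simp add: b_def c_def)
    also have "\<dots> \<le> (C + real k * g) / (real k * c - b)\<^sup>2"
      using elim by (intro divide_right_mono C) auto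
    finally have "real k * measure P {\<omega> \<in> space P. norm_wrt M (x k \<omega> /\<^sub>R real k) \<ge> \<epsilon>}
        \<le> real k * ((C + real k * g) / (real k * c - b)\<^sup>2)"
      by (intro mult_left_mono) auto
    also have "\<dots> = f k"
    proof -
      have "C + real k * g = real k * (C / real k + g)" using elim by (simp add: field_simps)
      then show ?thesis unfolding eq f_def using elim by (simp add: power_mult_distrib power2_eq_square)
    qed
    finally show ?case by simp
  qed
  then have "limsup (\<lambda>k. ereal (real k *
      measure P {\<omega> \<in> space P. norm_wrt M (x k \<omega> /\<^sub>R real k) \<ge> \<epsilon>})) \<le> limsup (\<lambda>k. ereal (f k))"
    by (rule Limsup_mono)
  also have "\<dots> = ereal (g / c\<^sup>2)"
    using lim by (intro lim_imp_Limsup) auto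
  finally show ?thesis by (simp add: g_def c_def)
qed

lemma limsup_prob_le:
  assumes v: "infimal_displacement_vector M T v" and \<epsilon>: "\<alpha> * norm_wrt M v < \<epsilon>"
  shows "limsup (\<lambda>k. ereal (real k *
      measure P {\<omega> \<in> space P. norm_wrt M (x k \<omega> /\<^sub>R real k) \<ge> \<epsilon>}))
    \<le> ereal ((\<beta> - \<alpha>\<^sup>2) * (norm_wrt M v)\<^sup>2 / (\<epsilon> - \<alpha> * norm_wrt M v)\<^sup>2)"
    (is "?S \<le> _")
proof -
  define L where "L = norm_wrt M v"
  have v_in: "v \<in> closure (range R)"
    and v_min: "\<And>u. u \<in> closure (range R) \<Longrightarrow> L \<le> norm_wrt M u"
    using v unfolding infimal_displacement_vector_def is_arg_min_linorder L_def by auto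
  have L: "0 \<le> L" "\<And>y. L \<le> norm_wrt M (R y)"
    by (simp add: L_def, rule v_min, rule subsetD[OF closure_subset rangeI])
  obtain u where u: "\<And>n. u n \<in> range R" "u \<longlonglongrightarrow> v"
    using v_in unfolding closure_sequential by metis
  have "\<exists>y. u n = R y" for n using u(1)[of n] by (rule rangeE) (rule exI)
  then obtain z where z: "\<And>n. u n = R (z n)" by metis
  define \<rho> where "\<rho> n = norm_wrt M (R (z n))" for n
  have \<rho>: "\<rho> \<longlonglongrightarrow> L"
  proof -
    have "continuous_on UNIV (norm_wrt M)" using continuous_on_norm_wrt[OF continuous_on_id] .
    then have "isCont (norm_wrt M) v" by (simp add: continuous_on_eq_continuous_at)
    then have "(\<lambda>n. norm_wrt M (u n)) \<longlonglongrightarrow> L"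
      unfolding L_def using u(2) by (rule isCont_tendsto_compose)
    then show ?thesis by (simp add: \<rho>_def[abs_def] z)
  qed
  have c: "0 < \<epsilon> - \<alpha> * L" using \<epsilon> by (simp add: L_def)
  \<comment> \<open>First limit: starting points whose displacement tends to v, with \<sigma> fixed. The
    summand of growth that is divided by \<sigma> disappears.\<close>
  have near: "?S \<le> ereal (growth L \<sigma> L / (\<epsilon> - \<alpha> * L)\<^sup>2)" if \<sigma>: "0 < \<sigma>" for \<sigma>
  proof (rule tendsto_lowerbound)
    have "(\<lambda>n. growth L \<sigma> (\<rho> n) / (\<epsilon> - \<alpha> * \<rho> n)\<^sup>2) \<longlonglongrightarrow> growth L \<sigma> L / (\<epsilon> - \<alpha> * L)\<^sup>2"
      unfolding growth_def using c \<sigma> alpha_theta_less_1 alpha theta by (intro tendsto_intros \<rho>) auto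
    then show "(\<lambda>n. ereal (growth L \<sigma> (\<rho> n) / (\<epsilon> - \<alpha> * \<rho> n)\<^sup>2))
        \<longlonglongrightarrow> ereal (growth L \<sigma> L / (\<epsilon> - \<alpha> * L)\<^sup>2)" by simp
    have "(\<lambda>n. \<epsilon> - \<alpha> * \<rho> n) \<longlonglongrightarrow> \<epsilon> - \<alpha> * L" by (intro tendsto_intros \<rho>)
    then have "\<forall>\<^sub>F n in sequentially. 0 < \<epsilon> - \<alpha> * \<rho> n" using c by (rule order_tendstoD(1))
    then show "\<forall>\<^sub>F n in sequentially. ?S \<le> ereal (growth L \<sigma> (\<rho> n) / (\<epsilon> - \<alpha> * \<rho> n)\<^sup>2)"
    proof eventually_elim
      case (elim n)
      then show ?case
        unfolding \<rho>_def by (intro limsup_prob_le_growth \<sigma> L) simp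
    qed
  qed simp
  \<comment> \<open>Second limit: \<sigma> tends to 0.\<close>
  have "?S \<le> ereal (((\<beta> - \<alpha>\<^sup>2) * L\<^sup>2 + 2 * 0 * (drift * L\<^sup>2)) / (\<epsilon> - \<alpha> * L)\<^sup>2)"
  proof (rule tendsto_lowerbound)
    have "((\<lambda>\<sigma>. ((\<beta> - \<alpha>\<^sup>2) * L\<^sup>2 + 2 * \<sigma> * (drift * L\<^sup>2)) / (\<epsilon> - \<alpha> * L)\<^sup>2)
        \<longlongrightarrow> ((\<beta> - \<alpha>\<^sup>2) * L\<^sup>2 + 2 * 0 * (drift * L\<^sup>2)) / (\<epsilon> - \<alpha> * L)\<^sup>2) (at_right 0)"
      using c by (intro tendsto_intros) auto
    then show "((\<lambda>\<sigma>. ereal (((\<beta> - \<alpha>\<^sup>2) * L\<^sup>2 + 2 * \<sigma> * (drift * L\<^sup>2)) / (\<epsilon> - \<alpha> * L)\<^sup>2))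
        \<longlongrightarrow> ereal (((\<beta> - \<alpha>\<^sup>2) * L\<^sup>2 + 2 * 0 * (drift * L\<^sup>2)) / (\<epsilon> - \<alpha> * L)\<^sup>2)) (at_right 0)" by simp
    show "\<forall>\<^sub>F \<sigma> in at_right 0. ?S
        \<le> ereal (((\<beta> - \<alpha>\<^sup>2) * L\<^sup>2 + 2 * \<sigma> * (drift * L\<^sup>2)) / (\<epsilon> - \<alpha> * L)\<^sup>2)"
      using eventually_at_right_less[of "0::real"]
      by eventually_elim (use near in \<open>simp add: growth_def\<close>)
  qed simp
  then show ?thesis by (simp add: L_def)
qed

end

theorem theorem6p1:
  fixes H :: "'m::finite \<Rightarrow> 'a::{real_inner,complete_space} set"
    and M T :: "'a \<Rightarrow> 'a" and v x0 :: 'a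
    and \<theta> \<alpha> \<beta> \<delta> \<epsilon> :: real
    and P :: "'w measure" and \<mu> :: "(real^'m) measure"
    and sel :: "nat \<Rightarrow> 'w \<Rightarrow> real^'m" and x :: "nat \<Rightarrow> 'w \<Rightarrow> 'a"
  assumes "\<exists>u::'a. u \<noteq> 0"
    and "hilbert_direct_sum H"
    and "positive_definite_operator M" and "complete_wrt M"
    and "0 < \<theta>" and "\<theta> \<le> 1" and "averaged M \<theta> T"
    and "infimal_displacement_vector M T v"
    and "prob_space P"
    and "prob_space.indep_vars P (\<lambda>_. borel) sel UNIV"
    and "\<And>k. distr P borel (sel k) = \<mu>"
    and "\<And>k \<omega>. \<omega> \<in> space P \<Longrightarrow> sel k \<omega> \<in> cbox 0 1"
    and "0 < \<alpha>" and "\<alpha> \<le> 1"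
    and "(\<integral>s. s \<partial>\<mu>) = \<alpha> *\<^sub>R 1"
    and "0 < \<beta>" and "\<beta> < \<alpha> / \<theta>"
    and "\<And>u. (\<integral>s. (norm_wrt M (vec_sel H u s))\<^sup>2 \<partial>\<mu>) \<le> \<beta> * (norm_wrt M u)\<^sup>2"
    and "\<And>\<omega>. \<omega> \<in> space P \<Longrightarrow> x 0 \<omega> = x0"
    and "\<And>k \<omega>. \<omega> \<in> space P \<Longrightarrow> x (Suc k) \<omega> = T_sel H \<theta> T (sel k \<omega>) (x k \<omega>)"
    and "0 < \<delta>" and "norm_wrt M v \<le> \<delta>" and "\<alpha> * \<delta> < \<epsilon>"
  shows "limsup (\<lambda>k. ereal (real k *
             measure P {\<omega> \<in> space P. norm_wrt M (x k \<omega> /\<^sub>R real k) \<ge> \<epsilon>}))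
         \<le> ereal ((\<beta> - \<alpha>\<^sup>2) * \<delta>\<^sup>2 / (\<epsilon> - \<alpha> * \<delta>)\<^sup>2)"
proof -
  interpret P: prob_space P by fact
  have sel: "sel k \<in> borel_measurable P" for k
    using assms(10) by (simp add: P.indep_vars_def)
  have prob_mu: "prob_space \<mu>"
    unfolding assms(11)[of 0, symmetric] by (rule P.prob_space_distr[OF sel])
  have sets_mu: "sets \<mu> = sets borel"
    unfolding assms(11)[of 0, symmetric] by simp
  have AE_mu: "AE s in \<mu>. s \<in> cbox 0 1"
    unfolding assms(11)[of 0, symmetric]
    by (subst AE_distr_iff[OF sel]) (auto simp: assms(12))
  interpret random_block_iteration M H T \<theta> \<alpha> \<beta> \<mu> P sel x x0
    by (intro random_block_iteration.intro positive_definite.intro random_block_step.intro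
        random_block_step_axioms.intro random_block_iteration_axioms.intro)
      (fact assms prob_mu sets_mu AE_mu)+
  have le: "\<alpha> * norm_wrt M v \<le> \<alpha> * \<delta>" using assms by simp
  have "limsup (\<lambda>k. ereal (real k *
      measure P {\<omega> \<in> space P. norm_wrt M (x k \<omega> /\<^sub>R real k) \<ge> \<epsilon>}))
    \<le> ereal ((\<beta> - \<alpha>\<^sup>2) * (norm_wrt M v)\<^sup>2 / (\<epsilon> - \<alpha> * norm_wrt M v)\<^sup>2)"
    by (rule limsup_prob_le[OF assms(8)]) (use assms(23) le in linarith)
  also have "\<dots> \<le> ereal ((\<beta> - \<alpha>\<^sup>2) * \<delta>\<^sup>2 / (\<epsilon> - \<alpha> * \<delta>)\<^sup>2)"
    unfolding ereal_less_eq
    using assms le alpha_sq_le_beta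
    by (intro frac_le mult_mono power_mono) auto
  finally show ?thesis .
qed

end
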